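(* Let $r,s$ be positive integers and $\eta=r+s$. Let $\boldsymbol{\gamma}=(\gamma_{ij})\in T^{\mathrm{diag}}((s^r),\mathbb{N})$ and $\boldsymbol{\delta}=(\delta_{ij})\in T^{\mathrm{diag}}((r^s),\mathbb{N})$, and write $c_k=\gamma_{i,i+k}$ and $d_k=\delta_{i,i+k}$ for $k\in\mathbb{Z}$. Then $$\sum_{\lambda\subset(s^r)}(-1)^{|\lambda|}S_\lambda(\boldsymbol{\gamma}|_\lambda)\,S_{\lambda^*}(\boldsymbol{\delta}|_{\lambda^*})=\det\begin{bmatrix}P\\Q\end{bmatrix},$$ where $P=[P_{ij}]_{1\le i\le r,1\le j\le\eta}$ and $Q=[Q_{ij}]_{1\le i\le s,1\le j\le\eta}$ (stacked with $P$ on top of $Q$) are given by $$P_{ij}=\begin{cases}E_{(c_{i-r},c_{i+1-r},\ldots,c_{j-1-r})}&i<j,\\1&i=j,\\0&i>j,\end{cases}\qquad Q_{ij}=\begin{cases}E_{(d_{i-s},d_{i+1-s},\ldots,d_{j-1-s})}&i<j,\\1&i=j,\\0&i>j.\end{cases}$$ Here $\boldsymbol{\gamma}|_\lambda\in T^{\mathrm{diag}}(\lambda,\mathbb{N})$ and $\boldsymbol{\delta}|_{\lambda^*}\in T^{\mathrm{diag}}(\lambda^*,\mathbb{N})$ are the restrictions of $\boldsymbol{\gamma}$ and $\boldsymbol{\delta}$ to the shapes $\lambda$ and $\lambda^*$.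
   Context: $\mathbb{N}$ denotes the positive integers and $t_1,t_2,\ldots$ are commuting variables; identities hold among formal power series of bounded degree over $\mathbb{Z}$. $(s^r)$ is the partition with $r$ parts equal to $s$. The sum is over all partitions $\lambda=(\lambda_1,\ldots,\lambda_r)$ (zero parts allowed) with all $\lambda_i\le s$, and $\lambda^*=(r-\lambda'_s,\ldots,r-\lambda'_1)\subset(r^s)$, where $\lambda'_i=\#\{j:\lambda_j\ge i\}$. $|\lambda|=\sum\lambda_i$. $D(\lambda)=\{(i,j):1\le j\le\lambda_i\}$; $T(\lambda,\mathbb{N})$ is the set of fillings of $D(\lambda)$ by positive integers, $T^{\mathrm{diag}}(\lambda,\mathbb{N})$ the subset with $t_{ij}=t_{kl}$ whenever $j-i=l-k$, $\mathrm{SSYT}(\lambda)$ the subset of semi-standard ones (rows weakly increasing, columns strictly increasing). $S_\lambda(\boldsymbol{\gamma})=\sum_{(m_{ij})\in\mathrm{SSYT}(\lambda)}\prod_{(i,j)\in D(\lambda)}t_{m_{ij}}^{\gamma_{ij}}$ (with $S_\emptyset=1$), and $E_{(\gamma_1,\ldots,\gamma_n)}=\sum_{m_1\le\cdots\le m_n}t_{m_1}^{\gamma_1}\cdots t_{m_n}^{\gamma_n}$. *)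

theory Defs
  imports
    "HOL-Library.Poly_Mapping"
    "HOL-Library.FuncSet"
    "Jordan_Normal_Form.Determinant"
begin

section \<open>Formal power series in infinitely many commuting variables\<close>

text \<open>A monomial is a finitely supported exponent vector, a series is an arbitrary function from
  monomials to coefficients. The series of bounded degree form a subring; an identity between such
  series is an identity in this ring.\<close>

typedef 'a mseries = "UNIV :: ((nat \<Rightarrow>\<^sub>0 nat) \<Rightarrow> 'a) set"
  morphisms mcoeff Abs_mseries
  by simp

setup_lifting type_definition_mseries

lemma mseries_eqI: "(\<And>\<mu>. mcoeff f \<mu> = mcoeff g \<mu>) \<Longrightarrow> f = g"
  by (metis ext mcoeff_inject)

definition splits :: "(nat \<Rightarrow>\<^sub>0 nat) \<Rightarrow> ((nat \<Rightarrow>\<^sub>0 nat) \<times> (nat \<Rightarrow>\<^sub>0 nat)) set" where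
  "splits \<mu> = {(\<alpha>, \<beta>). \<alpha> + \<beta> = \<mu>}"

lemma finite_splits [simp, intro]: "finite (splits \<mu>)"
proof -
  let ?K = "Poly_Mapping.keys \<mu>"
  let ?h = "\<lambda>p. restrict (Poly_Mapping.lookup (fst p)) ?K"
  have "?h ` splits \<mu> \<subseteq> (\<Pi>\<^sub>E k\<in>?K. {..Poly_Mapping.lookup \<mu> k})"
    by (auto simp: splits_def lookup_add)
  moreover have "finite (\<Pi>\<^sub>E k\<in>?K. {..Poly_Mapping.lookup \<mu> k})"
    by (intro finite_PiE) auto
  ultimately have fin: "finite (?h ` splits \<mu>)"
    by (rule finite_subset)
  have "inj_on ?h (splits \<mu>)"
  proof (rule inj_onI)
    fix p q assume p: "p \<in> splits \<mu>" and q: "q \<in> splits \<mu>" and eq: "?h p = ?h q"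
    have "Poly_Mapping.lookup (fst p) k = Poly_Mapping.lookup (fst q) k" for k
    proof (cases "k \<in> ?K")
      case True
      then show ?thesis using fun_cong[OF eq, of k] by simp
    next
      case False
      then have 0: "Poly_Mapping.lookup \<mu> k = 0" by (simp add: in_keys_iff)
      have "Poly_Mapping.lookup (fst p + snd p) k = 0" "Poly_Mapping.lookup (fst q + snd q) k = 0"
        using p q 0 by (auto simp: splits_def)
      then show ?thesis by (simp add: lookup_add)
    qed
    then have f: "fst p = fst q" by (rule poly_mapping_eqI)
    have "fst p + snd p = fst q + snd q" using p q by (auto simp: splits_def)
    with f show "p = q" by (simp add: prod_eq_iff)
  qed
  with fin show ?thesis by (rule finite_imageD)
qed

instantiation mseries :: (comm_ring_1) comm_ring_1
begin

lift_definition zero_mseries :: "'a mseries" is "\<lambda>_. 0" .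
lift_definition one_mseries :: "'a mseries" is "\<lambda>\<mu>. if \<mu> = 0 then 1 else 0" .
lift_definition plus_mseries :: "'a mseries \<Rightarrow> 'a mseries \<Rightarrow> 'a mseries" is "\<lambda>f g \<mu>. f \<mu> + g \<mu>" .
lift_definition minus_mseries :: "'a mseries \<Rightarrow> 'a mseries \<Rightarrow> 'a mseries" is "\<lambda>f g \<mu>. f \<mu> - g \<mu>" .
lift_definition uminus_mseries :: "'a mseries \<Rightarrow> 'a mseries" is "\<lambda>f \<mu>. - f \<mu>" .
lift_definition times_mseries :: "'a mseries \<Rightarrow> 'a mseries \<Rightarrow> 'a mseries"
  is "\<lambda>f g \<mu>. \<Sum>(\<alpha>, \<beta>)\<in>splits \<mu>. f \<alpha> * g \<beta>" .

instance
proof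
  fix a b c :: "'a mseries"
  show "a * b * c = a * (b * c)"
  proof (rule mseries_eqI)
    fix \<mu>
    let ?A = "SIGMA p:splits \<mu>. splits (fst p)"
    let ?B = "SIGMA p:splits \<mu>. splits (snd p)"
    have "mcoeff (a * b * c) \<mu> =
      (\<Sum>(p, q)\<in>?A. mcoeff a (fst q) * mcoeff b (snd q) * mcoeff c (snd p))"
      unfolding times_mseries.rep_eq case_prod_unfold sum_distrib_right
      by (subst sum.Sigma) (auto simp: case_prod_unfold)
    also have "\<dots> = (\<Sum>(p, q)\<in>?B. mcoeff a (fst p) * mcoeff b (fst q) * mcoeff c (snd q))"
      by (rule sum.reindex_bij_witness[of _
            "\<lambda>(p, q). ((fst p + fst q, snd q), (fst p, fst q))"
            "\<lambda>(p, q). ((fst q, snd q + snd p), (snd q, snd p))"])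
        (auto simp: splits_def add.assoc)
    also have "\<dots> = mcoeff (a * (b * c)) \<mu>"
      unfolding times_mseries.rep_eq case_prod_unfold sum_distrib_left
      by (subst sum.Sigma) (auto simp: case_prod_unfold mult.assoc)
    finally show "mcoeff (a * b * c) \<mu> = mcoeff (a * (b * c)) \<mu>" .
  qed
  show "a * b = b * a"
  proof (rule mseries_eqI)
    fix \<mu>
    show "mcoeff (a * b) \<mu> = mcoeff (b * a) \<mu>"
      unfolding times_mseries.rep_eq
      by (rule sum.reindex_bij_witness[of _ prod.swap prod.swap])
        (auto simp: splits_def add.commute mult.commute)
  qed
  show "1 * a = a"
  proof (rule mseries_eqI)
    fix \<mu>
    have "mcoeff (1 * a) \<mu> = (\<Sum>p\<in>splits \<mu>. if p = (0, \<mu>) then mcoeff a \<mu> else 0)"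
      unfolding times_mseries.rep_eq one_mseries.rep_eq
      by (rule sum.cong) (auto simp: splits_def split: if_splits)
    also have "\<dots> = mcoeff a \<mu>"
      by (simp add: sum.delta) (simp add: splits_def)
    finally show "mcoeff (1 * a) \<mu> = mcoeff a \<mu>" .
  qed
  show "(a + b) * c = a * c + b * c"
    by (rule mseries_eqI)
      (simp add: times_mseries.rep_eq plus_mseries.rep_eq case_prod_unfold distrib_right
        sum.distrib)
  show "(0 :: 'a mseries) \<noteq> 1"
    by transfer (metis zero_neq_one)
qed (transfer; auto simp: algebra_simps)+

end

text \<open>There is one variable for each natural number; only those with positive index are used
  below.\<close>

lift_definition mvar :: "nat \<Rightarrow> 'a::comm_ring_1 mseries"
  is "\<lambda>k \<mu>. if \<mu> = Poly_Mapping.single k 1 then 1 else 0" .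

text \<open>Infinite sum, taken coefficientwise. It is meaningful when each monomial occurs in only
  finitely many summands.\<close>

definition summable_mseries :: "'i set \<Rightarrow> ('i \<Rightarrow> 'a::comm_ring_1 mseries) \<Rightarrow> bool" where
  "summable_mseries A f \<longleftrightarrow> (\<forall>\<mu>. finite {i \<in> A. mcoeff (f i) \<mu> \<noteq> 0})"

lift_definition mseries_sum :: "'i set \<Rightarrow> ('i \<Rightarrow> 'a::comm_ring_1 mseries) \<Rightarrow> 'a mseries"
  is "\<lambda>A f \<mu>. \<Sum>i | i \<in> A \<and> f i \<mu> \<noteq> 0. f i \<mu>" .

section \<open>Partitions and tableaux\<close>

text \<open>Partitions are weakly decreasing lists; zero parts are kept, so the length is part of the
  data. Cells \<open>(i, j)\<close> are 1-based.\<close>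

definition partitions_in_box :: "nat \<Rightarrow> nat \<Rightarrow> nat list set" where
  "partitions_in_box r s = {\<nu>. length \<nu> = r \<and> sorted_wrt (\<ge>) \<nu> \<and> (\<forall>x\<in>set \<nu>. x \<le> s)}"

definition diagram :: "nat list \<Rightarrow> (nat \<times> nat) set" where
  "diagram \<nu> = {(i, j). 1 \<le> i \<and> i \<le> length \<nu> \<and> 1 \<le> j \<and> j \<le> \<nu> ! (i - 1)}"

definition conj_part :: "nat list \<Rightarrow> nat \<Rightarrow> nat" where
  "conj_part \<nu> i = card {j. 1 \<le> j \<and> j \<le> length \<nu> \<and> \<nu> ! (j - 1) \<ge> i}"

text \<open>The list \<open>[r - \<nu>'\<^sub>s, \<dots>, r - \<nu>'\<^sub>1]\<close>; the subtractions do not truncate when \<open>length \<nu> = r\<close>.\<close>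

definition dual_partition :: "nat \<Rightarrow> nat \<Rightarrow> nat list \<Rightarrow> nat list" where
  "dual_partition r s \<nu> = map (\<lambda>i. r - conj_part \<nu> i) (rev [1..<Suc s])"

definition fillings :: "nat list \<Rightarrow> (nat \<times> nat \<Rightarrow> nat) set" where
  "fillings \<nu> = diagram \<nu> \<rightarrow>\<^sub>E {1..}"

definition diag_fillings :: "nat list \<Rightarrow> (nat \<times> nat \<Rightarrow> nat) set" where
  "diag_fillings \<nu> = {t \<in> fillings \<nu>. \<forall>i j k l. (i, j) \<in> diagram \<nu> \<longrightarrow> (k, l) \<in> diagram \<nu> \<longrightarrow>
     int j - int i = int l - int k \<longrightarrow> t (i, j) = t (k, l)}"

definition SSYT :: "nat list \<Rightarrow> (nat \<times> nat \<Rightarrow> nat) set" where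
  "SSYT \<nu> = {m \<in> fillings \<nu>.
     (\<forall>i j k. (i, j) \<in> diagram \<nu> \<longrightarrow> (i, k) \<in> diagram \<nu> \<longrightarrow> j < k \<longrightarrow> m (i, j) \<le> m (i, k)) \<and>
     (\<forall>i j k. (i, j) \<in> diagram \<nu> \<longrightarrow> (k, j) \<in> diagram \<nu> \<longrightarrow> i < k \<longrightarrow> m (i, j) < m (k, j))}"

definition schur_S :: "nat list \<Rightarrow> (nat \<times> nat \<Rightarrow> nat) \<Rightarrow> int mseries" where
  "schur_S \<nu> \<gamma> = mseries_sum (SSYT \<nu>) (\<lambda>m. \<Prod>p\<in>diagram \<nu>. mvar (m p) ^ \<gamma> p)"

definition weak_chains :: "nat \<Rightarrow> nat list set" where
  "weak_chains n = {ms. length ms = n \<and> sorted ms \<and> (\<forall>x\<in>set ms. 1 \<le> x)}"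

definition E_series :: "nat list \<Rightarrow> int mseries" where
  "E_series \<gamma>s = mseries_sum (weak_chains (length \<gamma>s)) (\<lambda>ms. \<Prod>k<length \<gamma>s. mvar (ms ! k) ^ (\<gamma>s ! k))"

text \<open>The \<open>n \<times> \<eta>\<close> block with 1-based entries as below; \<open>P\<close> is the case \<open>n = r\<close>, and \<open>Q\<close> is the
  case \<open>n = s\<close>. Matrices of the library are 0-based, hence the shift.\<close>

definition block_entry :: "nat \<Rightarrow> (int \<Rightarrow> nat) \<Rightarrow> nat \<Rightarrow> nat \<Rightarrow> int mseries" where
  "block_entry n c i j =
     (if i < j then E_series (map c [int i - int n .. int j - 1 - int n])
      else if i = j then 1 else 0)"

definition block_mat :: "nat \<Rightarrow> nat \<Rightarrow> (int \<Rightarrow> nat) \<Rightarrow> int mseries mat" where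
  "block_mat n \<eta> c = mat n \<eta> (\<lambda>(i, j). block_entry n c (Suc i) (Suc j))"

section \<open>The infinite sums are meaningful\<close>

definition mmonom :: "(nat \<Rightarrow>\<^sub>0 nat) \<Rightarrow> 'a::comm_ring_1 mseries" where
  "mmonom \<alpha> = Abs_mseries (\<lambda>\<mu>. if \<mu> = \<alpha> then 1 else 0)"

lemma mcoeff_mmonom: "mcoeff (mmonom \<alpha>) \<mu> = (if \<mu> = \<alpha> then 1 else 0)"
  by (simp add: mmonom_def Abs_mseries_inverse)

lemma mmonom_mult: "mmonom \<alpha> * mmonom \<beta> = mmonom (\<alpha> + \<beta>)"
proof (rule mseries_eqI)
  fix \<mu>
  have "mcoeff (mmonom \<alpha> * mmonom \<beta> :: 'a mseries) \<mu> =
      (\<Sum>p\<in>splits \<mu>. if p = (\<alpha>, \<beta>) then 1 else 0)"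
    unfolding times_mseries.rep_eq mcoeff_mmonom by (rule sum.cong) (auto split: if_splits)
  also have "\<dots> = mcoeff (mmonom (\<alpha> + \<beta>)) \<mu>"
    by (simp add: mcoeff_mmonom) (auto simp: splits_def)
  finally show "mcoeff (mmonom \<alpha> * mmonom \<beta> :: 'a mseries) \<mu> = mcoeff (mmonom (\<alpha> + \<beta>)) \<mu>" .
qed

lemma mmonom_0: "mmonom 0 = 1"
  by (rule mseries_eqI) (simp add: mcoeff_mmonom one_mseries.rep_eq)

lemma mvar_power: "mvar k ^ n = mmonom (Poly_Mapping.single k n)"
proof (induction n)
  case 0
  then show ?case by (simp add: mmonom_0)
next
  case (Suc n)
  have "mvar k = (mmonom (Poly_Mapping.single k 1) :: 'a mseries)"
    by (rule mseries_eqI) (simp add: mcoeff_mmonom mvar.rep_eq)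
  then have "mvar k ^ Suc n = (mmonom (Poly_Mapping.single k 1 + Poly_Mapping.single k n) :: 'a mseries)"
    by (metis power_Suc Suc mmonom_mult)
  then show ?case
    by (simp add: single_add[symmetric])
qed

lemma prod_mvar_power:
  "finite A \<Longrightarrow> (\<Prod>p\<in>A. mvar (m p) ^ g p) = mmonom (\<Sum>p\<in>A. Poly_Mapping.single (m p) (g p))"
  by (induction A rule: finite_induct) (auto simp: mmonom_0 mmonom_mult mvar_power)

lemma prod_mvar_power_coeff_nonzero:
  assumes "finite A" "p \<in> A" "g p > 0"
    and nz: "mcoeff (\<Prod>p\<in>A. mvar (m p) ^ g p :: 'a::comm_ring_1 mseries) \<mu> \<noteq> 0"
  shows "m p \<in> Poly_Mapping.keys \<mu>"
proof -
  have \<mu>: "\<mu> = (\<Sum>p\<in>A. Poly_Mapping.single (m p) (g p))"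
    using nz by (auto simp: prod_mvar_power[OF assms(1)] mcoeff_mmonom split: if_splits)
  have "g p \<le> Poly_Mapping.lookup \<mu> (m p)"
    unfolding \<mu> lookup_sum
    using member_le_sum[of p A "\<lambda>q. Poly_Mapping.lookup (Poly_Mapping.single (m q) (g q)) (m p)"]
      assms(1,2) by simp
  with assms(3) show ?thesis by (simp add: in_keys_iff)
qed

lemma finite_diagram [simp]: "finite (diagram \<nu>)"
proof -
  have "diagram \<nu> \<subseteq> (SIGMA i:{1..length \<nu>}. {1..\<nu> ! (i - 1)})"
    by (auto simp: diagram_def)
  then show ?thesis by (rule finite_subset) auto
qed

lemma summable_schur_S:
  assumes "\<gamma> \<in> fillings \<nu>"
  shows "summable_mseries (SSYT \<nu>) (\<lambda>m. \<Prod>p\<in>diagram \<nu>. mvar (m p) ^ \<gamma> p :: int mseries)"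
  unfolding summable_mseries_def
proof
  fix \<mu>
  have pos: "\<gamma> p > 0" if "p \<in> diagram \<nu>" for p
  proof -
    have "\<gamma> p \<in> {1..}" using assms that by (metis PiE_mem fillings_def)
    then show ?thesis by simp
  qed
  have "m \<in> diagram \<nu> \<rightarrow>\<^sub>E Poly_Mapping.keys \<mu>"
    if m: "m \<in> SSYT \<nu>"
      and nz: "mcoeff (\<Prod>p\<in>diagram \<nu>. mvar (m p) ^ \<gamma> p :: int mseries) \<mu> \<noteq> 0" for m
  proof (rule PiE_I)
    fix p assume p: "p \<in> diagram \<nu>"
    show "m p \<in> Poly_Mapping.keys \<mu>"
      by (rule prod_mvar_power_coeff_nonzero[OF finite_diagram p pos[OF p] nz])
  next
    fix p assume p: "p \<notin> diagram \<nu>"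
    have "m \<in> diagram \<nu> \<rightarrow>\<^sub>E {1..}" using m unfolding SSYT_def fillings_def by blast
    then show "m p = undefined" using p by (rule PiE_arb)
  qed
  then have "{m \<in> SSYT \<nu>. mcoeff (\<Prod>p\<in>diagram \<nu>. mvar (m p) ^ \<gamma> p :: int mseries) \<mu> \<noteq> 0}
      \<subseteq> (diagram \<nu> \<rightarrow>\<^sub>E Poly_Mapping.keys \<mu>)"
    by blast
  moreover have "finite (diagram \<nu> \<rightarrow>\<^sub>E Poly_Mapping.keys \<mu>)"
    by (intro finite_PiE) auto
  ultimately show "finite {m \<in> SSYT \<nu>.
      mcoeff (\<Prod>p\<in>diagram \<nu>. mvar (m p) ^ \<gamma> p :: int mseries) \<mu> \<noteq> 0}"
    by (rule finite_subset)
qed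

lemma summable_E_series:
  assumes "\<forall>x\<in>set \<gamma>s. 1 \<le> x"
  shows "summable_mseries (weak_chains (length \<gamma>s))
    (\<lambda>ms. \<Prod>k<length \<gamma>s. mvar (ms ! k) ^ (\<gamma>s ! k) :: int mseries)"
  unfolding summable_mseries_def
proof
  fix \<mu>
  let ?X = "{ms \<in> weak_chains (length \<gamma>s).
    mcoeff (\<Prod>k<length \<gamma>s. mvar (ms ! k) ^ (\<gamma>s ! k) :: int mseries) \<mu> \<noteq> 0}"
  have "?X \<subseteq> {ms. set ms \<subseteq> Poly_Mapping.keys \<mu> \<and> length ms = length \<gamma>s}"
  proof safe
    fix ms x
    assume ms: "ms \<in> weak_chains (length \<gamma>s)" and x: "x \<in> set ms"
      and nz: "mcoeff (\<Prod>k<length \<gamma>s. mvar (ms ! k) ^ (\<gamma>s ! k) :: int mseries) \<mu> \<noteq> 0"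
    have len: "length ms = length \<gamma>s" using ms by (simp add: weak_chains_def)
    obtain k where k: "k < length \<gamma>s" "x = ms ! k" using x len by (metis in_set_conv_nth)
    have "\<gamma>s ! k \<ge> 1" using assms k(1) by simp
    then show "x \<in> Poly_Mapping.keys \<mu>"
      using prod_mvar_power_coeff_nonzero[of "{..<length \<gamma>s}" k "\<lambda>k. \<gamma>s ! k" "\<lambda>k. ms ! k" \<mu>] k nz
      by simp
  qed (simp add: weak_chains_def)
  then show "finite ?X"
    by (rule finite_subset) (simp add: finite_lists_length_eq)
qed

end

theory Submission
  imports Defs
begin

text \<open>The determinant on the right is expanded along its first \<open>r\<close> rows. The choice of \<open>r\<close> of the
  \<open>r + s\<close> columns is the same as a partition \<open>\<nu>\<close> in the \<open>r \<times> s\<close> box, the complementary columns are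
  those of the dual partition, and the sign of the Laplace expansion is \<open>(- 1) ^ sum_list \<nu>\<close>
  (\<open>laplace_expansion_by_partitions\<close>). The two minors that belong to \<open>\<nu>\<close> are Jacobi-Trudi
  determinants, so that they are the two tableau sums on the left.

  It remains to prove the Jacobi-Trudi identity for exponents that are constant along diagonals
  (\<open>jacobi_trudi_le\<close>). This is done by adding the variables one at a time. On the side of
  tableaux, the cells that carry the largest entry form a horizontal strip (\<open>schur_le_Suc\<close>). On
  the side of determinants, a new variable multiplies the block from the right by a unitriangular
  matrix, because its power at a cell depends only on the content of the cell; by a Cauchy-Binet
  argument, a minor turns into a sum over interlacing minors (\<open>minor_interlacing_expansion\<close>).
  Horizontal strips and interlacing columns are the same thing, weights included.

  An identity between series in infinitely many variables follows from its truncations to the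
  variables with index at most \<open>N\<close>, for all \<open>N\<close> (\<open>trunc_eqI\<close>). Truncation is a ring homomorphism,
  hence compatible with determinants, and turns the infinite sums over tableaux and chains into
  finite ones (\<open>trunc_mseries_sum\<close>).\<close>

section \<open>Laplace expansion along the first rows over a commutative ring\<close>

text \<open>Padding with an identity block is the case of the block product formula that Laplace
  expansion along a single row settles; together with its mirror image it yields the formula for
  two arbitrary blocks by multiplicativity. Over a general commutative ring neither division nor
  cancellation is available.\<close>

lemma det_extend_right:
  fixes f :: "nat \<Rightarrow> nat \<Rightarrow> 'a::comm_ring_1"
  shows "det (mat (n + m) (n + m) (\<lambda>(i, j). if i < n \<and> j < n then f i j else if i = j then 1 else 0))
    = det (mat n n (\<lambda>(i, j). f i j))"
proof (induction m)
  case 0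
  show ?case by (simp, intro arg_cong[where f = det] eq_matI) auto
next
  case (Suc m)
  let ?M = "\<lambda>m. mat (n + m) (n + m) (\<lambda>(i, j). if i < n \<and> j < n then f i j else if i = j then 1 else 0)"
  have "det (?M (Suc m)) = (\<Sum>j<n + Suc m. ?M (Suc m) $$ (n + m, j) * cofactor (?M (Suc m)) (n + m) j)"
    by (rule laplace_expansion_row) auto
  also have "\<dots> = (\<Sum>j<n + Suc m. if j = n + m then cofactor (?M (Suc m)) (n + m) (n + m) else 0)"
    by (rule sum.cong) auto
  also have "\<dots> = det (mat_delete (?M (Suc m)) (n + m) (n + m))"
    by (simp add: cofactor_def flip: mult_2)
  also have "mat_delete (?M (Suc m)) (n + m) (n + m) = ?M m"
    by (rule eq_matI) (auto simp: mat_delete_def)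
  finally show ?case using Suc by simp
qed

lemma det_extend_left:
  fixes g :: "nat \<Rightarrow> nat \<Rightarrow> 'a::comm_ring_1"
  shows "det (mat (n + m) (n + m)
      (\<lambda>(i, j). if n \<le> i \<and> n \<le> j then g (i - n) (j - n) else if i = j then 1 else 0))
    = det (mat m m (\<lambda>(i, j). g i j))"
proof (induction n)
  case 0
  show ?case by simp
next
  case (Suc n)
  let ?M = "\<lambda>n. mat (n + m) (n + m)
      (\<lambda>(i, j). if n \<le> i \<and> n \<le> j then g (i - n) (j - n) else if i = j then 1 else 0)"
  have "det (?M (Suc n)) = (\<Sum>j<Suc n + m. ?M (Suc n) $$ (0, j) * cofactor (?M (Suc n)) 0 j)"
    by (rule laplace_expansion_row) auto
  also have "\<dots> = (\<Sum>j<Suc n + m. if j = 0 then cofactor (?M (Suc n)) 0 0 else 0)"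
    by (rule sum.cong) auto
  also have "\<dots> = det (mat_delete (?M (Suc n)) 0 0)"
    by (simp add: cofactor_def)
  also have "mat_delete (?M (Suc n)) 0 0 = ?M n"
    by (rule eq_matI) (auto simp: mat_delete_def)
  finally show ?case using Suc by simp
qed

lemma det_block_diagonal:
  fixes f g :: "nat \<Rightarrow> nat \<Rightarrow> 'a::comm_ring_1"
  shows "det (mat (n + m) (n + m) (\<lambda>(i, j).
      if i < n \<and> j < n then f i j else if n \<le> i \<and> n \<le> j then g (i - n) (j - n) else 0))
    = det (mat n n (\<lambda>(i, j). f i j)) * det (mat m m (\<lambda>(i, j). g i j))"
    (is "det ?M = _")
proof -
  let ?F = "mat (n + m) (n + m) (\<lambda>(i, j). if i < n \<and> j < n then f i j else if i = j then 1 else 0)"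
  let ?G = "mat (n + m) (n + m)
      (\<lambda>(i, j). if n \<le> i \<and> n \<le> j then g (i - n) (j - n) else if i = j then 1 else 0)"
  have "?M = ?F * ?G"
  proof (rule eq_matI)
    fix i j assume "i < dim_row (?F * ?G)" "j < dim_col (?F * ?G)"
    then have i: "i < n + m" and j: "j < n + m" by auto
    have "(?F * ?G) $$ (i, j) = (\<Sum>k<n + m. ?F $$ (i, k) * ?G $$ (k, j))"
      using i j by (simp add: scalar_prod_def atLeast0LessThan)
    also have "\<dots> = (\<Sum>k<n + m. if k = (if i < n then j else i) then ?M $$ (i, j) else 0)"
      using i j by (intro sum.cong refl) auto
    also have "\<dots> = ?M $$ (i, j)" using i j by simp
    finally show "?M $$ (i, j) = (?F * ?G) $$ (i, j)" by simp
  qed auto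
  then have "det ?M = det ?F * det ?G" by (simp add: det_mult[of _ "n + m"])
  then show ?thesis by (simp only: det_extend_right det_extend_left)
qed

text \<open>Laplace expansion along the first \<open>r\<close> rows, before the minors are separated: the permutation
  \<open>\<sigma>\<close> of the Leibniz formula is classified by \<open>J = \<sigma> ` {..<r}\<close>, and zeroing the entries that are
  incompatible with \<open>J\<close> kills exactly the terms of the permutations with another image.\<close>

lemma det_sum_over_column_sets:
  fixes A :: "nat \<Rightarrow> nat \<Rightarrow> 'a::comm_ring_1"
  assumes "r \<le> n"
  shows "det (mat n n (\<lambda>(i, j). A i j)) =
    (\<Sum>J | J \<subseteq> {..<n} \<and> card J = r.
      det (mat n n (\<lambda>(i, j). if i < r \<longleftrightarrow> j \<in> J then A i j else 0)))"
proof -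
  let ?C = "{J. J \<subseteq> {..<n} \<and> card J = r}"
  let ?P = "{\<sigma>. \<sigma> permutes {0..<n}}"
  define z where "z J i j = (if i < r \<longleftrightarrow> j \<in> J then A i j else 0)" for J i j
  have fin: "finite ?C" by simp
  have leibniz: "det (mat n n (\<lambda>(i, j). B i j)) = (\<Sum>\<sigma>\<in>?P. signof \<sigma> * (\<Prod>i<n. B i (\<sigma> i)))"
    for B :: "nat \<Rightarrow> nat \<Rightarrow> 'a"
  proof -
    have "(\<Prod>i = 0..<n. mat n n (\<lambda>(i, j). B i j) $$ (i, \<sigma> i)) = (\<Prod>i<n. B i (\<sigma> i))"
      if "\<sigma> \<in> ?P" for \<sigma>
    proof (rule prod.cong)
      fix i assume "i \<in> {..<n}"
      then show "mat n n (\<lambda>(i, j). B i j) $$ (i, \<sigma> i) = B i (\<sigma> i)"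
        using permutes_in_image[of \<sigma> "{0..<n}" i] that by simp
    qed auto
    then have "(\<Sum>\<sigma>\<in>?P. signof \<sigma> * (\<Prod>i = 0..<n. mat n n (\<lambda>(i, j). B i j) $$ (i, \<sigma> i))) =
        (\<Sum>\<sigma>\<in>?P. signof \<sigma> * (\<Prod>i<n. B i (\<sigma> i)))"
      by (intro sum.cong refl) simp
    then show ?thesis using det_def'[of "mat n n (\<lambda>(i, j). B i j)" n] by simp
  qed
  have expand: "(\<Prod>i<n. A i (\<sigma> i)) = (\<Sum>J\<in>?C. \<Prod>i<n. z J i (\<sigma> i))" if "\<sigma> \<in> ?P" for \<sigma>
  proof -
    from that have \<sigma>: "\<sigma> permutes {0..<n}" by simp
    have inj: "inj \<sigma>" using \<sigma> by (rule permutes_inj)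
    have card: "card (\<sigma> ` {..<r}) = r" 
      by (simp add: card_image[OF inj_on_subset[OF inj subset_UNIV]])
    have img: "\<sigma> ` {..<n} = {..<n}" using permutes_image[OF \<sigma>] by (simp add: atLeast0LessThan)
    have mem: "\<sigma> ` {..<r} \<in> ?C"
      using img card image_mono[of "{..<r}" "{..<n}" \<sigma>] assms by simp
    have "(\<Prod>i<n. z J i (\<sigma> i)) = (if J = \<sigma> ` {..<r} then \<Prod>i<n. A i (\<sigma> i) else 0)"
      if J: "J \<in> ?C" for J
    proof (cases "J = \<sigma> ` {..<r}")
      case True
      have "(i < r) = (\<sigma> i \<in> J)" for i
        unfolding True inj_image_mem_iff[OF inj] by simp
      then have "z J i (\<sigma> i) = A i (\<sigma> i)" for i by (simp add: z_def)
      then show ?thesis using True by simp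
    next
      case False
      have "\<exists>i<n. \<not> (i < r \<longleftrightarrow> \<sigma> i \<in> J)"
      proof (rule ccontr)
        assume "\<not> ?thesis"
        then have "\<sigma> i \<in> J" if "i < r" for i using that assms by (meson order_less_le_trans)
        then have "\<sigma> ` {..<r} \<subseteq> J" by blast
        moreover have "card (\<sigma> ` {..<r}) = card J" using J card by simp
        moreover have "finite J" using J by (auto intro: finite_subset)
        ultimately show False using False by (metis card_subset_eq)
      qed
      then have "(\<Prod>i<n. z J i (\<sigma> i)) = 0" by (intro prod_zero) (auto simp: z_def)
      then show ?thesis using False by simp
    qed
    then have "(\<Sum>J\<in>?C. \<Prod>i<n. z J i (\<sigma> i)) =
        (\<Sum>J\<in>?C. if J = \<sigma> ` {..<r} then \<Prod>i<n. A i (\<sigma> i) else 0)"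
      by (intro sum.cong refl) blast
    then show ?thesis using mem fin by (simp only: sum.delta if_True)
  qed
  have "det (mat n n (\<lambda>(i, j). A i j)) = (\<Sum>\<sigma>\<in>?P. signof \<sigma> * (\<Prod>i<n. A i (\<sigma> i)))"
    by (rule leibniz)
  also have "\<dots> = (\<Sum>\<sigma>\<in>?P. \<Sum>J\<in>?C. signof \<sigma> * (\<Prod>i<n. z J i (\<sigma> i)))"
    by (intro sum.cong refl) (simp only: expand sum_distrib_left)
  also have "\<dots> = (\<Sum>J\<in>?C. \<Sum>\<sigma>\<in>?P. signof \<sigma> * (\<Prod>i<n. z J i (\<sigma> i)))"
    by (rule sum.swap)
  also have "\<dots> = (\<Sum>J\<in>?C. det (mat n n (\<lambda>(i, j). z J i j)))"
    by (simp only: leibniz)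
  finally show ?thesis by (simp only: z_def)
qed

text \<open>The sign comes from sorting the columns by adjacent transpositions. If \<open>J\<close> has a gap, say
  \<open>j \<notin> J\<close> and \<open>Suc j \<in> J\<close>, then exchanging the columns \<open>j\<close> and \<open>Suc j\<close> of the matrix lowers \<open>\<Sum>J\<close>
  by one and negates the determinant, while both minors stay the same: the exchange is increasing
  on \<open>J\<close> and on its complement, so it respects their sorted enumerations. Without a gap
  \<open>J = {..<r}\<close>, and the matrix is block diagonal.\<close>

lemma det_zeroed_to_column_set:
  fixes A :: "nat \<Rightarrow> nat \<Rightarrow> 'a::comm_ring_1"
  assumes "J \<subseteq> {..<r + s}" "card J = r"
  shows "det (mat (r + s) (r + s) (\<lambda>(i, j). if i < r \<longleftrightarrow> j \<in> J then A i j else 0)) =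
    (- 1) ^ (\<Sum>J + \<Sum>{..<r})
    * det (mat r r (\<lambda>(i, k). A i (sorted_list_of_set J ! k)))
    * det (mat s s (\<lambda>(i, k). A (r + i) (sorted_list_of_set ({..<r + s} - J) ! k)))"
  using assms
proof (induction "\<Sum>J" arbitrary: J A rule: less_induct)
  case less
  note J = less.prems
  have finJ: "finite J" using J(1) by (rule finite_subset) simp
  let ?n = "r + s"
  show ?case
  proof (cases "\<exists>j. j \<notin> J \<and> Suc j \<in> J")
    case False
    have down: "j \<in> J" if "j \<le> m" "m \<in> J" for j m
      using that by (induction rule: inc_induct) (use False in blast)+
    have "J = {..<r}"
    proof -
      have "J \<subseteq> {..<r}"
      proof
        fix m assume "m \<in> J"
        then have "{..m} \<subseteq> J" using down by blast
        from card_mono[OF finJ this] J(2) show "m \<in> {..<r}" by simp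
      qed
      then show ?thesis using J(2) by (intro card_subset_eq) auto
    qed
    have compl: "{..<?n} - {..<r} = {r..<?n}" by auto
    have [simp]: "sorted_list_of_set {..<r} = [0..<r]" 
      by (metis atLeast0LessThan sorted_list_of_set_range)
    have "mat ?n ?n (\<lambda>(i, j). if i < r \<longleftrightarrow> j \<in> J then A i j else 0) =
        mat ?n ?n (\<lambda>(i, j). if i < r \<and> j < r then A i j
          else if r \<le> i \<and> r \<le> j then A (r + (i - r)) (r + (j - r)) else 0)"
      unfolding \<open>J = {..<r}\<close> by (rule eq_matI) auto
    then have "det (mat ?n ?n (\<lambda>(i, j). if i < r \<longleftrightarrow> j \<in> J then A i j else 0)) =
        det (mat r r (\<lambda>(i, j). A i j)) * det (mat s s (\<lambda>(i, j). A (r + i) (r + j)))"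
      by (simp only: det_block_diagonal[of r s A "\<lambda>i j. A (r + i) (r + j)"])
    moreover have "mat r r (\<lambda>(i, k). A i (sorted_list_of_set J ! k)) = mat r r (\<lambda>(i, j). A i j)"
      unfolding \<open>J = {..<r}\<close> by (rule eq_matI) auto
    moreover have "mat s s (\<lambda>(i, k). A (r + i) (sorted_list_of_set ({..<?n} - J) ! k)) =
        mat s s (\<lambda>(i, j). A (r + i) (r + j))"
      unfolding \<open>J = {..<r}\<close> compl by (rule eq_matI) auto
    ultimately show ?thesis
      using \<open>J = {..<r}\<close> by (simp flip: mult_2)
  next
    case True
    then obtain j where j: "j \<notin> J" "Suc j \<in> J" by blast
    define t where "t = Transposition.transpose j (Suc j)"
    have t_simps: "t j = Suc j" "t (Suc j) = j" "\<And>k. k \<noteq> j \<Longrightarrow> k \<noteq> Suc j \<Longrightarrow> t k = k"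
      by (auto simp: t_def)
    have tt: "t (t k) = k" for k by (simp add: t_def)
    have t_less: "t k < ?n \<longleftrightarrow> k < ?n" for k
      using j(2) J(1) by (auto simp: t_def Transposition.transpose_def)
    define J' where "J' = t ` J"
    have J'_mem: "k \<in> J' \<longleftrightarrow> t k \<in> J" for k
      unfolding J'_def by (metis (no_types, lifting) image_iff tt)
    have inj: "inj_on t X" for X by (metis inj_onI tt)
    have J': "J' \<subseteq> {..<?n}" "card J' = r"
      using J t_less by (auto simp: J'_def card_image[OF inj])
    have J'_eq: "J' = insert j (J - {Suc j})"
    proof (rule Set.set_eqI)
      fix k
      show "k \<in> J' \<longleftrightarrow> k \<in> insert j (J - {Suc j})"
        using j t_simps(1,2) t_simps(3)[of k] by (cases "k = j \<or> k = Suc j") (auto simp: J'_mem)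
    qed
    have sum: "\<Sum>J = Suc (\<Sum>J')"
      unfolding J'_eq using j finJ by (simp add: sum.remove)
    \<comment> \<open>Only the pair \<open>(j, Suc j)\<close> is inverted by \<open>t\<close>, and \<open>X\<close> does not contain both.\<close>
    have sorted_image: "sorted_list_of_set (t ` X) = map t (sorted_list_of_set X)"
      if fin: "finite X" and one: "\<not> (j \<in> X \<and> Suc j \<in> X)" for X
    proof -
      have "sorted_wrt (<) (map t (sorted_list_of_set X))"
        unfolding sorted_wrt_map
      proof (rule sorted_wrt_mono_rel)
        show "sorted_wrt (<) (sorted_list_of_set X)" by simp
        fix x y assume "x \<in> set (sorted_list_of_set X)" "y \<in> set (sorted_list_of_set X)" "x < y"
        then show "t x < t y" using one fin by (auto simp: t_def Transposition.transpose_def)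
      qed
      then show ?thesis
        using fin by (intro sorted_distinct_set_unique)
          (auto simp: strict_sorted_iff)
    qed
    let ?A' = "\<lambda>i k. A i (t k)"
    let ?z = "\<lambda>A J. mat ?n ?n (\<lambda>(i, j). if i < r \<longleftrightarrow> j \<in> J then A i j else 0)"
    have "Suc j < ?n" using j J by auto
    have "?z A J = swapcols j (Suc j) (?z ?A' J')"
      by (rule eq_matI) (use \<open>Suc j < ?n\<close> in \<open>auto simp: J'_mem t_def Transposition.transpose_def\<close>)
    then have "det (?z A J) = - det (?z ?A' J')"
      using det_swapcols[of j ?n "Suc j" "?z ?A' J'"] \<open>Suc j < ?n\<close> by simp
    also have "det (?z ?A' J') = (- 1) ^ (\<Sum>J' + \<Sum>{..<r})
      * det (mat r r (\<lambda>(i, k). ?A' i (sorted_list_of_set J' ! k)))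
      * det (mat s s (\<lambda>(i, k). ?A' (r + i) (sorted_list_of_set ({..<?n} - J') ! k)))"
      by (rule less.hyps) (use sum J' in auto)
    also have "mat r r (\<lambda>(i, k). ?A' i (sorted_list_of_set J' ! k)) =
        mat r r (\<lambda>(i, k). A i (sorted_list_of_set J ! k))"
    proof -
      have "sorted_list_of_set J' = map t (sorted_list_of_set J)"
        unfolding J'_def using j finJ by (intro sorted_image) auto
      then show ?thesis using J by (intro eq_matI) (auto simp: tt)
    qed
    also have "mat s s (\<lambda>(i, k). ?A' (r + i) (sorted_list_of_set ({..<?n} - J') ! k)) =
        mat s s (\<lambda>(i, k). A (r + i) (sorted_list_of_set ({..<?n} - J) ! k))"
    proof -
      have "{..<?n} - J' = t ` ({..<?n} - J)"
      proof (rule Set.set_eqI)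
        fix k
        have "k \<in> t ` X \<longleftrightarrow> t k \<in> X" for X by (metis (no_types, lifting) image_iff tt)
        then show "k \<in> {..<?n} - J' \<longleftrightarrow> k \<in> t ` ({..<?n} - J)"
          by (simp add: J'_mem t_less)
      qed
      then have "sorted_list_of_set ({..<?n} - J') = map t (sorted_list_of_set ({..<?n} - J))"
        using j by (auto intro: sorted_image)
      moreover have "card ({..<?n} - J) = s" using J finJ by (simp add: card_Diff_subset)
      ultimately show ?thesis by (intro eq_matI) (auto simp: tt)
    qed
    finally show ?thesis by (simp add: sum)
  qed
qed

section \<open>Minors under right multiplication by a unitriangular matrix\<close>

text \<open>Multilinearity in all columns at once. The index sets may depend on the column, which is
  what the interlacing condition below requires.\<close>

lemma det_sum_columns:
  fixes W :: "nat \<Rightarrow> 'k \<Rightarrow> 'a::comm_ring_1"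
  assumes fin: "\<And>a. a < n \<Longrightarrow> finite (S a)"
  shows "det (mat n n (\<lambda>(i, a). \<Sum>k\<in>S a. W a k * p i k)) =
    (\<Sum>K\<in>Pi\<^sub>E {..<n} S. (\<Prod>a<n. W a (K a)) * det (mat n n (\<lambda>(i, a). p i (K a))))"
proof -
  have "det (mat n n (\<lambda>(i, a). \<Sum>k\<in>S a. W a k * p i k)) =
      (\<Sum>\<sigma> | \<sigma> permutes {0..<n}. signof \<sigma> * (\<Prod>a<n. \<Sum>k\<in>S a. W a k * p (\<sigma> a) k))"
    by (subst det_col[of _ n]) (auto intro!: sum.cong prod.cong dest: permutes_in_image)
  also have "\<dots> = (\<Sum>\<sigma> | \<sigma> permutes {0..<n}.
      \<Sum>K\<in>Pi\<^sub>E {..<n} S. signof \<sigma> * (\<Prod>a<n. W a (K a) * p (\<sigma> a) (K a)))"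
    by (subst prod_sum_PiE) (auto simp: fin sum_distrib_left)
  also have "\<dots> = (\<Sum>K\<in>Pi\<^sub>E {..<n} S. (\<Prod>a<n. W a (K a)) *
      (\<Sum>\<sigma> | \<sigma> permutes {0..<n}. signof \<sigma> * (\<Prod>a<n. p (\<sigma> a) (K a))))"
    by (subst sum.swap) (simp add: sum_distrib_left prod.distrib mult.left_commute)
  also have "\<dots> = (\<Sum>K\<in>Pi\<^sub>E {..<n} S. (\<Prod>a<n. W a (K a)) *
      det (mat n n (\<lambda>(i, a). p i (K a))))"
    by (intro sum.cong refl arg_cong2[of _ _ _ _ "(*)"], subst det_col[of _ n])
      (auto intro!: sum.cong prod.cong dest: permutes_in_image)
  finally show ?thesis .
qed

text \<open>This is the Cauchy-Binet formula for passing from \<open>p\<close> to \<open>q = p T\<close>, where \<open>T\<close> is the inverse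
  of the unitriangular bidiagonal matrix with entries \<open>- x j\<close> above the diagonal. Column \<open>j\<close> of
  \<open>q\<close> is the sum of the columns \<open>k \<le> j\<close> of \<open>p\<close> weighted by \<open>x k \<dots> x (j - 1)\<close>; the part with
  \<open>k \<le> l\<close> is a multiple of column \<open>l\<close> of \<open>q\<close>. In a minor it can therefore be subtracted with the
  help of the previous chosen column \<open>l\<close>, and the new columns \<open>K a\<close> that remain interlace with the
  old ones: \<open>J (a - 1) < K a \<le> J a\<close>.\<close>

lemma minor_interlacing_expansion:
  fixes p q :: "nat \<Rightarrow> nat \<Rightarrow> 'a::comm_ring_1"
  assumes q_0: "\<And>i. i < n \<Longrightarrow> q i 0 = p i 0"
    and q_Suc: "\<And>i j. i < n \<Longrightarrow> q i (Suc j) = p i (Suc j) + x j * q i j"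
    and incr: "\<And>a. Suc a < n \<Longrightarrow> J a < J (Suc a)"
  shows "det (mat n n (\<lambda>(i, a). q i (J a))) =
    (\<Sum>K\<in>(\<Pi>\<^sub>E a\<in>{..<n}. {(if a = 0 then 0 else Suc (J (a - 1)))..J a}).
      (\<Prod>a<n. \<Prod>m\<in>{K a..<J a}. x m) * det (mat n n (\<lambda>(i, a). p i (K a))))"
proof -
  define lo where "lo a = (if a = 0 then 0 else Suc (J (a - 1)))" for a
  define w where "w k l = (\<Prod>m\<in>{k..<l}. x m)" for k l
  have w_Suc: "w k (Suc l) = x l * w k l" if "k \<le> l" for k l
    using that by (simp add: w_def atLeastLessThanSuc mult.commute)
  have w_self [simp]: "w k k = 1" for k by (simp add: w_def)
  have unroll: "q i j = (\<Sum>k\<in>{Suc l..j}. w k j * p i k) + w l j * q i l" if "i < n" "l \<le> j" for i j l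
    using that(2)
  proof (induction rule: dec_induct)
    case (step j)
    have "(\<Sum>k\<in>{Suc l..Suc j}. w k (Suc j) * p i k) =
        x j * (\<Sum>k\<in>{Suc l..j}. w k j * p i k) + p i (Suc j)"
      using step.hyps by (simp add: w_Suc sum_distrib_left mult.assoc)
    moreover have "q i (Suc j) = p i (Suc j) + x j * q i j" using q_Suc that(1) by blast
    ultimately show ?case using step by (simp add: w_Suc algebra_simps)
  qed simp
  have unroll_0: "q i j = (\<Sum>k\<in>{0..j}. w k j * p i k)" if "i < n" for i j
    using unroll[OF that, of 0 j] q_0[OF that] by (simp add: sum.atLeast_Suc_atMost add.commute)
  define R where "R i a = (\<Sum>k\<in>{lo a..J a}. w k (J a) * p i k)" for i a
  let ?Q = "mat n n (\<lambda>(i, a). q i (J a))"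
  \<comment> \<open>Right multiplication by \<open>?U\<close> subtracts from every column its multiple of the preceding one.\<close>
  let ?U = "mat n n (\<lambda>(b, a). if b = a then 1 else if Suc b = a then - w (J b) (J a) else 0)"
  have "mat n n (\<lambda>(i, a). R i a) = ?Q * ?U"
  proof (rule eq_matI)
    fix i a assume "i < dim_row (?Q * ?U)" "a < dim_col (?Q * ?U)"
    then have i: "i < n" and a: "a < n" by auto
    have "(?Q * ?U) $$ (i, a) =
        (\<Sum>b<n. q i (J b) * (if b = a then 1 else if Suc b = a then - w (J b) (J a) else 0))"
      using i a by (simp add: scalar_prod_def atLeast0LessThan)
    also have "\<dots> = R i a"
    proof (cases a)
      case 0
      have "(\<Sum>b<n. q i (J b) * (if b = a then 1 else if Suc b = a then - w (J b) (J a) else 0)) =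
          (\<Sum>b<n. if b = a then q i (J a) else 0)"
        by (rule sum.cong) (auto simp: 0)
      also have "\<dots> = R i a" using a 0 unroll_0[OF i, of "J 0"] by (simp add: R_def lo_def)
      finally show ?thesis .
    next
      case (Suc b')
      have "(\<Sum>b<n. q i (J b) * (if b = a then 1 else if Suc b = a then - w (J b) (J a) else 0)) =
          (\<Sum>b<n. (if b = a then q i (J a) else 0) + (if b = b' then - w (J b') (J a) * q i (J b') else 0))"
        by (rule sum.cong) (auto simp: Suc)
      also have "\<dots> = q i (J a) - w (J b') (J a) * q i (J b')"
        using a Suc by (simp add: sum.distrib)
      also have "\<dots> = R i a"
        using unroll[OF i, of "J b'" "J a"] incr[of b'] a Suc by (simp add: R_def lo_def)
      finally show ?thesis .
    qed
    finally show "mat n n (\<lambda>(i, a). R i a) $$ (i, a) = (?Q * ?U) $$ (i, a)" using i a by simp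
  qed auto
  moreover have "det ?U = 1"
  proof -
    have "det ?U = prod_list (diag_mat ?U)"
      by (rule det_upper_triangular[of _ n]) (auto simp: upper_triangular_def)
    also have "diag_mat ?U = replicate n 1"
      by (rule nth_equalityI) (auto simp: diag_mat_def)
    finally show ?thesis by simp
  qed
  ultimately have "det ?Q = det (mat n n (\<lambda>(i, a). R i a))"
    by (simp add: det_mult[of _ n])
  also have "\<dots> = (\<Sum>K\<in>(\<Pi>\<^sub>E a\<in>{..<n}. {lo a..J a}).
      (\<Prod>a<n. w (K a) (J a)) * det (mat n n (\<lambda>(i, a). p i (K a))))"
    unfolding R_def by (rule det_sum_columns) simp
  finally show ?thesis by (simp only: lo_def w_def)
qed

section \<open>Bounded semistandard tableaux and horizontal strips\<close>

definition SSYT_le :: "nat \<Rightarrow> nat list \<Rightarrow> (nat \<times> nat \<Rightarrow> nat) set" where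
  "SSYT_le N \<nu> = {m \<in> SSYT \<nu>. \<forall>p\<in>diagram \<nu>. m p \<le> N}"

definition schur_le :: "nat \<Rightarrow> (int \<Rightarrow> nat) \<Rightarrow> nat list \<Rightarrow> int mseries" where
  "schur_le N c \<nu> = (\<Sum>m\<in>SSYT_le N \<nu>. \<Prod>(i, j)\<in>diagram \<nu>. mvar (m (i, j)) ^ c (int j - int i))"

text \<open>The shapes that remain when a horizontal strip is taken off \<open>\<nu>\<close>. The condition
  \<open>\<nu> ! Suc p \<le> \<kappa> ! p\<close> says that no two removed cells lie in one column.\<close>

definition strip_removals :: "nat list \<Rightarrow> nat list set" where
  "strip_removals \<nu> = {\<kappa>. length \<kappa> = length \<nu> \<and>
     (\<forall>p<length \<nu>. \<kappa> ! p \<le> \<nu> ! p \<and> (Suc p < length \<nu> \<longrightarrow> \<nu> ! Suc p \<le> \<kappa> ! p))}"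

lemma finite_SSYT_le [simp]: "finite (SSYT_le N \<nu>)"
proof (rule finite_subset)
  show "SSYT_le N \<nu> \<subseteq> diagram \<nu> \<rightarrow>\<^sub>E {..N}"
    by (auto simp: SSYT_le_def SSYT_def fillings_def PiE_def Pi_def)
qed (intro finite_PiE; simp)

lemma finite_strip_removals [simp]: "finite (strip_removals \<nu>)"
proof (rule finite_subset)
  show "strip_removals \<nu> \<subseteq> {\<kappa>. set \<kappa> \<subseteq> {..sum_list \<nu>} \<and> length \<kappa> = length \<nu>}"
  proof (safe)
    fix \<kappa> x assume \<kappa>: "\<kappa> \<in> strip_removals \<nu>" and "x \<in> set \<kappa>"
    then obtain p where "p < length \<nu>" "x = \<kappa> ! p"
      by (auto simp: strip_removals_def in_set_conv_nth)
    then have "x \<le> \<nu> ! p" "\<nu> ! p \<le> sum_list \<nu>" using \<kappa>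
      by (auto simp: strip_removals_def intro: member_le_sum_list)
    then show "x \<le> sum_list \<nu>" by (rule order_trans)
  qed (auto simp: strip_removals_def)
qed (simp add: finite_lists_length_eq)

lemma diagram_inject:
  assumes "length \<kappa> = length \<nu>" "diagram \<kappa> = diagram \<nu>"
  shows "\<kappa> = \<nu>"
proof (rule nth_equalityI)
  fix p assume p: "p < length \<kappa>"
  have row: "{j. (Suc p, j) \<in> diagram \<mu>} = {1..\<mu> ! p}" if "p < length \<mu>" for \<mu>
    using that by (auto simp: diagram_def)
  have "{1..\<kappa> ! p} = {j. (Suc p, j) \<in> diagram \<kappa>}" by (rule row[OF p, symmetric])
  also have "\<dots> = {1..\<nu> ! p}" unfolding assms(2) by (rule row) (use p assms(1) in simp)
  finally have "{1..\<kappa> ! p} = {1..\<nu> ! p}" .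
  from arg_cong[OF this, of card] show "\<kappa> ! p = \<nu> ! p" by simp
qed (rule assms)

lemma initial_segment_eq_atLeastAtMost:
  assumes "\<And>j k. 1 \<le> j \<Longrightarrow> j \<le> k \<Longrightarrow> k \<le> L \<Longrightarrow> P k \<Longrightarrow> P j"
  shows "{j::nat. 1 \<le> j \<and> j \<le> L \<and> P j} = {1..card {j. 1 \<le> j \<and> j \<le> L \<and> P j}}"
proof -
  let ?X = "{j. 1 \<le> j \<and> j \<le> L \<and> P j}"
  have fin: "finite ?X" by (rule finite_subset[of _ "{..L}"]) auto
  have "\<exists>M. ?X = {1..M}"
  proof (cases "?X = {}")
    case True
    then show ?thesis by (intro exI[of _ 0]) simp
  next
    case False
    define M where "M = Max ?X"
    have M: "M \<le> L" "P M" using Max_in[OF fin False] unfolding M_def by blast+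
    have "j \<le> M" if "j \<in> ?X" for j using that fin unfolding M_def by (rule Max_ge[rotated])
    then have "?X \<subseteq> {1..M}" by auto
    moreover have "{1..M} \<subseteq> ?X" using assms[of _ M] M by auto
    ultimately show ?thesis by blast
  qed
  then obtain M where "?X = {1..M}" ..
  then show ?thesis by simp
qed

text \<open>The cells with entry at most \<open>N\<close> form a diagram, because rows increase weakly. The remaining
  cells all carry \<open>Suc N\<close>, so strict increase along columns allows at most one of them per
  column.\<close>

lemma SSYT_le_remove_strip:
  assumes \<nu>: "sorted_wrt (\<ge>) \<nu>" and m: "m \<in> SSYT_le (Suc N) \<nu>"
  defines "\<kappa> \<equiv> map (\<lambda>p. card {j. 1 \<le> j \<and> j \<le> \<nu> ! p \<and> m (Suc p, j) \<le> N}) [0..<length \<nu>]"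
  shows "diagram \<kappa> = {q \<in> diagram \<nu>. m q \<le> N}"
    and "\<kappa> \<in> strip_removals \<nu>"
    and "restrict m (diagram \<kappa>) \<in> SSYT_le N \<kappa>"
proof -
  have row: "m (i, j) \<le> m (i, k)" if "(i, j) \<in> diagram \<nu>" "(i, k) \<in> diagram \<nu>" "j \<le> k" for i j k
    using m that by (cases "j = k") (auto simp: SSYT_le_def SSYT_def)
  have col: "m (i, j) < m (k, j)" if "(i, j) \<in> diagram \<nu>" "(k, j) \<in> diagram \<nu>" "i < k" for i j k
    using m that by (auto simp: SSYT_le_def SSYT_def)
  have len: "length \<kappa> = length \<nu>" by (simp add: \<kappa>_def)
  have seg: "{j. 1 \<le> j \<and> j \<le> \<nu> ! p \<and> m (Suc p, j) \<le> N} = {1..\<kappa> ! p}" if p: "p < length \<nu>" for p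
  proof -
    have "m (Suc p, j) \<le> N" if "1 \<le> j" "j \<le> k" "k \<le> \<nu> ! p" "m (Suc p, k) \<le> N" for j k
      using row[of "Suc p" j k] that p by (auto simp: diagram_def)
    from initial_segment_eq_atLeastAtMost[of "\<nu> ! p" "\<lambda>j. m (Suc p, j) \<le> N", OF this]
    show ?thesis using p by (simp add: \<kappa>_def)
  qed
  show diag: "diagram \<kappa> = {q \<in> diagram \<nu>. m q \<le> N}"
  proof -
    have "(i, j) \<in> diagram \<kappa> \<longleftrightarrow> (i, j) \<in> diagram \<nu> \<and> m (i, j) \<le> N" for i j
    proof (cases "1 \<le> i \<and> i \<le> length \<nu>")
      case True
      then obtain p where p: "i = Suc p" "p < length \<nu>" by (cases i) auto
      have "j \<in> {1..\<kappa> ! p} \<longleftrightarrow> 1 \<le> j \<and> j \<le> \<nu> ! p \<and> m (Suc p, j) \<le> N"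
        by (subst seg[OF p(2), symmetric]) simp
      then show ?thesis using p len by (auto simp: diagram_def)
    qed (auto simp: diagram_def len)
    then show ?thesis by auto
  qed
  show "\<kappa> \<in> strip_removals \<nu>"
    unfolding strip_removals_def
  proof (intro CollectI conjI allI impI len)
    fix p assume p: "p < length \<nu>"
    have "{1..\<kappa> ! p} \<subseteq> {1..\<nu> ! p}" by (subst seg[OF p, symmetric]) auto
    from card_mono[OF _ this] show "\<kappa> ! p \<le> \<nu> ! p" by simp
    assume p': "Suc p < length \<nu>"
    have le: "\<nu> ! Suc p \<le> \<nu> ! p" using \<nu> p' by (auto simp: sorted_wrt_iff_nth_less)
    have "j \<in> {1..\<kappa> ! p}" if j: "j \<in> {1..\<nu> ! Suc p}" for j
    proof -
      have cells: "(Suc p, j) \<in> diagram \<nu>" "(Suc (Suc p), j) \<in> diagram \<nu>"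
        using j p' le by (auto simp: diagram_def)
      then have "m (Suc (Suc p), j) \<le> Suc N" using m by (auto simp: SSYT_le_def)
      then have "m (Suc p, j) \<le> N" using col[OF cells] by simp
      then show ?thesis unfolding seg[OF p, symmetric] using j le by simp
    qed
    then have "{1..\<nu> ! Suc p} \<subseteq> {1..\<kappa> ! p}" by blast
    from card_mono[OF _ this] show "\<nu> ! Suc p \<le> \<kappa> ! p" by simp
  qed
  show "restrict m (diagram \<kappa>) \<in> SSYT_le N \<kappa>"
  proof -
    have "m q \<in> {1..}" if "q \<in> diagram \<nu>" for q
      using m that by (auto simp: SSYT_le_def SSYT_def fillings_def dest: PiE_mem)
    then show ?thesis
      using row col unfolding SSYT_le_def SSYT_def fillings_def diag by auto
  qed
qed

text \<open>Conversely, a horizontal strip may be filled with the new largest entry \<open>Suc N\<close>: a cell that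
  lies above another cell of \<open>\<nu>\<close> cannot belong to the strip, so no column gets this entry twice.\<close>

lemma SSYT_le_add_strip:
  assumes \<nu>: "sorted_wrt (\<ge>) \<nu>" and \<kappa>: "\<kappa> \<in> strip_removals \<nu>" and m: "m \<in> SSYT_le N \<kappa>"
  defines "m' \<equiv> \<lambda>q. if q \<in> diagram \<kappa> then m q else if q \<in> diagram \<nu> then Suc N else undefined"
  shows "m' \<in> SSYT_le (Suc N) \<nu>"
    and "{q \<in> diagram \<nu>. m' q \<le> N} = diagram \<kappa>"
proof -
  have len: "length \<kappa> = length \<nu>" and le: "\<And>p. p < length \<nu> \<Longrightarrow> \<kappa> ! p \<le> \<nu> ! p"
    using \<kappa> by (auto simp: strip_removals_def)
  have sub: "(i, j) \<in> diagram \<nu>" if "(i, j) \<in> diagram \<kappa>" for i j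
    using that le[of "i - 1"] by (cases i) (auto simp: diagram_def len)
  have row: "m (i, j) \<le> m (i, k)" if "(i, j) \<in> diagram \<kappa>" "(i, k) \<in> diagram \<kappa>" "j < k" for i j k
    using m that by (auto simp: SSYT_le_def SSYT_def)
  have col: "m (i, j) < m (k, j)" if "(i, j) \<in> diagram \<kappa>" "(k, j) \<in> diagram \<kappa>" "i < k" for i j k
    using m that by (auto simp: SSYT_le_def SSYT_def)
  have pos: "1 \<le> m q" "m q \<le> N" if "q \<in> diagram \<kappa>" for q
    using m that by (auto simp: SSYT_le_def SSYT_def fillings_def dest: PiE_mem)
  have left: "(i, j) \<in> diagram \<kappa>" if "(i, k) \<in> diagram \<kappa>" "(i, j) \<in> diagram \<nu>" "j < k" for i j k
    using that by (auto simp: diagram_def)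
  have above: "(i, j) \<in> diagram \<kappa>" if "(i, j) \<in> diagram \<nu>" "(k, j) \<in> diagram \<nu>" "i < k" for i j k
  proof -
    from that obtain p where p: "i = Suc p" "Suc p < length \<nu>" "Suc p \<le> k - 1" "k - 1 < length \<nu>"
      by (cases i) (auto simp: diagram_def)
    have "\<nu> ! (k - 1) \<le> \<nu> ! Suc p"
      using \<nu> p by (cases "Suc p = k - 1") (auto simp: sorted_wrt_iff_nth_less)
    moreover have "\<nu> ! Suc p \<le> \<kappa> ! p" using \<kappa> p by (auto simp: strip_removals_def)
    ultimately show ?thesis using that p by (auto simp: diagram_def len)
  qed
  show "{q \<in> diagram \<nu>. m' q \<le> N} = diagram \<kappa>"
    using pos sub by (auto simp: m'_def)
  have "m' \<in> diagram \<nu> \<rightarrow>\<^sub>E {1..}"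
    using pos sub by (auto simp: m'_def)
  moreover have "m' (i, j) \<le> m' (i, k)" if "(i, j) \<in> diagram \<nu>" "(i, k) \<in> diagram \<nu>" "j < k" for i j k
    using row[of i j k] left[of i k j] pos(2)[of "(i, j)"] that by (auto simp: m'_def)
  moreover have "m' (i, j) < m' (k, j)" if "(i, j) \<in> diagram \<nu>" "(k, j) \<in> diagram \<nu>" "i < k" for i j k
    using col[of i j k] above[of i j k] pos(2)[of "(i, j)"] that by (auto simp: m'_def)
  moreover have "m' q \<le> Suc N" if "q \<in> diagram \<nu>" for q
    using pos(2)[of q] that by (auto simp: m'_def)
  ultimately show "m' \<in> SSYT_le (Suc N) \<nu>"
    by (auto simp: SSYT_le_def SSYT_def fillings_def)
qed

text \<open>The branching rule: a tableau with entries up to \<open>Suc N\<close> is a tableau with entries up to \<open>N\<close>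
  on a smaller shape together with a horizontal strip of entries \<open>Suc N\<close>. Since the exponent of a
  cell depends only on its content, the weight of the smaller tableau is again governed by the
  same \<open>c\<close>.\<close>

lemma schur_le_Suc:
  assumes \<nu>: "sorted_wrt (\<ge>) \<nu>"
  shows "schur_le (Suc N) c \<nu> = (\<Sum>\<kappa>\<in>strip_removals \<nu>.
    (\<Prod>p<length \<nu>. \<Prod>j\<in>{Suc (\<kappa> ! p)..\<nu> ! p}. mvar (Suc N) ^ c (int j - int (Suc p)))
    * schur_le N c \<kappa>)"
proof -
  let ?wt = "\<lambda>\<nu> m. \<Prod>(i, j)\<in>diagram \<nu>. mvar (m (i, j)) ^ c (int j - int i) :: int mseries"
  let ?st = "\<lambda>\<kappa>. \<Prod>p<length \<nu>. \<Prod>j\<in>{Suc (\<kappa> ! p)..\<nu> ! p}. mvar (Suc N) ^ c (int j - int (Suc p)) :: int mseries"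
  define sh where "sh m = map (\<lambda>p. card {j. 1 \<le> j \<and> j \<le> \<nu> ! p \<and> m (Suc p, j) \<le> N}) [0..<length \<nu>]"
    for m :: "nat \<times> nat \<Rightarrow> nat"
  define ext where "ext \<kappa> m = (\<lambda>q. if q \<in> diagram \<kappa> then m q else if q \<in> diagram \<nu> then Suc N else undefined)"
    for \<kappa> and m :: "nat \<times> nat \<Rightarrow> nat"
  note rem = SSYT_le_remove_strip[OF \<nu>, where N = N, folded sh_def]
  note add = SSYT_le_add_strip[OF \<nu>, where N = N, folded ext_def]
  have ext_rem: "ext (sh m) (restrict m (diagram (sh m))) = m" if m: "m \<in> SSYT_le (Suc N) \<nu>" for m
  proof
    fix q
    have "m q = undefined" if "q \<notin> diagram \<nu>"
      using m that by (auto simp: SSYT_le_def SSYT_def fillings_def dest: PiE_arb)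
    moreover have "m q \<le> Suc N" if "q \<in> diagram \<nu>"
      using m that by (auto simp: SSYT_le_def)
    moreover have "q \<in> diagram (sh m) \<longleftrightarrow> q \<in> diagram \<nu> \<and> m q \<le> N"
      by (subst rem(1)[OF m]) simp
    ultimately show "ext (sh m) (restrict m (diagram (sh m))) q = m q"
      by (cases "q \<in> diagram \<nu>") (auto simp: ext_def le_Suc_eq)
  qed
  have sh_ext: "sh (ext \<kappa> m) = \<kappa>" if "\<kappa> \<in> strip_removals \<nu>" "m \<in> SSYT_le N \<kappa>" for \<kappa> m
  proof (rule diagram_inject)
    show "length (sh (ext \<kappa> m)) = length \<kappa>" using that by (simp add: sh_def strip_removals_def)
    have "diagram (sh (ext \<kappa> m)) = {q \<in> diagram \<nu>. ext \<kappa> m q \<le> N}"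
      by (rule rem(1)[OF add(1)[OF that]])
    also have "\<dots> = diagram \<kappa>" unfolding ext_def by (rule add(2)[OF that])
    finally show "diagram (sh (ext \<kappa> m)) = diagram \<kappa>" .
  qed
  have res_ext: "restrict (ext \<kappa> m) (diagram \<kappa>) = m" if m: "m \<in> SSYT_le N \<kappa>" for \<kappa> m
  proof
    fix q
    have "m q = undefined" if "q \<notin> diagram \<kappa>"
      using m that by (auto simp: SSYT_le_def SSYT_def fillings_def dest: PiE_arb)
    then show "restrict (ext \<kappa> m) (diagram \<kappa>) q = m q" by (auto simp: ext_def)
  qed
  have wt: "?st (sh m) * ?wt (sh m) (restrict m (diagram (sh m))) = ?wt \<nu> m"
    if m: "m \<in> SSYT_le (Suc N) \<nu>" for m
  proof -
    let ?\<kappa> = "sh m"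
    have sub: "diagram ?\<kappa> \<subseteq> diagram \<nu>" using rem(1)[OF m] by auto
    have len: "length ?\<kappa> = length \<nu>" by (simp add: sh_def)
    have top: "m q = Suc N" if "q \<in> diagram \<nu> - diagram ?\<kappa>" for q
      using rem(1)[OF m] that m by (auto simp: SSYT_le_def le_Suc_eq)
    have "?st ?\<kappa> = (\<Prod>(p, j)\<in>Sigma {..<length \<nu>} (\<lambda>p. {Suc (?\<kappa> ! p)..\<nu> ! p}).
        mvar (Suc N) ^ c (int j - int (Suc p)))"
      by (subst prod.Sigma) auto
    also have "\<dots> = (\<Prod>(i, j)\<in>diagram \<nu> - diagram ?\<kappa>. mvar (m (i, j)) ^ c (int j - int i))"
      by (rule prod.reindex_bij_witness[of _ "\<lambda>(i, j). (i - 1, j)" "\<lambda>(p, j). (Suc p, j)"])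
        (auto simp: diagram_def len top)
    finally have "?st ?\<kappa> = (\<Prod>(i, j)\<in>diagram \<nu> - diagram ?\<kappa>. mvar (m (i, j)) ^ c (int j - int i))" .
    moreover have "?wt ?\<kappa> (restrict m (diagram ?\<kappa>)) = ?wt ?\<kappa> m"
      by (rule prod.cong) auto
    ultimately show ?thesis
      using prod.subset_diff[OF sub finite_diagram,
          of "\<lambda>(i, j). mvar (m (i, j)) ^ c (int j - int i) :: int mseries"] by simp
  qed
  define W where "W \<kappa> m = ?st \<kappa> * ?wt \<kappa> m" for \<kappa> m
  have "schur_le (Suc N) c \<nu> = (\<Sum>m\<in>SSYT_le (Suc N) \<nu>. W (sh m) (restrict m (diagram (sh m))))"
    unfolding schur_le_def W_def by (intro sum.cong refl wt[symmetric])
  also have "\<dots> = (\<Sum>(\<kappa>, m)\<in>Sigma (strip_removals \<nu>) (SSYT_le N). W \<kappa> m)"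
    by (rule sum.reindex_bij_witness[of _ "\<lambda>(\<kappa>, m). ext \<kappa> m" "\<lambda>m. (sh m, restrict m (diagram (sh m)))"])
      (use rem(2,3) add(1) in \<open>auto simp: ext_rem sh_ext res_ext\<close>)
  also have "\<dots> = (\<Sum>\<kappa>\<in>strip_removals \<nu>. \<Sum>m\<in>SSYT_le N \<kappa>. W \<kappa> m)"
    by (rule sum.Sigma[symmetric]) auto
  also have "\<dots> = (\<Sum>\<kappa>\<in>strip_removals \<nu>. ?st \<kappa> * schur_le N c \<kappa>)"
    by (simp only: W_def schur_le_def sum_distrib_left)
  finally show ?thesis .
qed

lemma schur_le_0:
  "schur_le 0 c \<nu> = (if \<forall>x\<in>set \<nu>. x = 0 then 1 else 0)"
proof (cases "\<forall>x\<in>set \<nu>. x = 0")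
  case True
  then have "\<nu> ! p = 0" if "p < length \<nu>" for p using that by simp
  then have "diagram \<nu> = {}" by (force simp: diagram_def)
  then have "SSYT_le 0 \<nu> = {\<lambda>_. undefined}"
    by (auto simp: SSYT_le_def SSYT_def fillings_def)
  then show ?thesis using True \<open>diagram \<nu> = {}\<close> by (simp add: schur_le_def)
next
  case False
  then obtain p where "p < length \<nu>" "\<nu> ! p \<noteq> 0" by (metis in_set_conv_nth)
  then have q: "(Suc p, 1) \<in> diagram \<nu>" by (auto simp: diagram_def)
  have "SSYT_le 0 \<nu> = {}"
  proof (rule equals0I)
    fix m assume m: "m \<in> SSYT_le 0 \<nu>"
    then have "m (Suc p, 1) \<in> {1..}" using q
      by (auto simp: SSYT_le_def SSYT_def fillings_def dest!: PiE_mem[OF _ q])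
    moreover have "m (Suc p, 1) \<le> 0" using m q by (auto simp: SSYT_le_def)
    ultimately show False by simp
  qed
  then show ?thesis using False by (simp add: schur_le_def)
qed

section \<open>The Jacobi-Trudi identity in finitely many variables\<close>

definition chains_le :: "nat \<Rightarrow> nat \<Rightarrow> nat list set" where
  "chains_le N n = {ms \<in> weak_chains n. \<forall>x\<in>set ms. x \<le> N}"

definition complete_le :: "nat \<Rightarrow> nat list \<Rightarrow> int mseries" where
  "complete_le N cs = (\<Sum>ms\<in>chains_le N (length cs). \<Prod>k<length cs. mvar (ms ! k) ^ (cs ! k))"

text \<open>Indices are 0-based, as in the matrices. On the diagonal the content list is empty, which
  produces the entry 1.\<close>

definition block_le :: "nat \<Rightarrow> nat \<Rightarrow> (int \<Rightarrow> nat) \<Rightarrow> nat \<Rightarrow> nat \<Rightarrow> int mseries" where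
  "block_le N n c i j =
     (if i \<le> j then complete_le N (map c [int i + 1 - int n..int j - int n]) else 0)"

lemma finite_chains_le [simp]: "finite (chains_le N n)"
  by (rule finite_subset[of _ "{ms. set ms \<subseteq> {..N} \<and> length ms = n}"])
    (auto simp: chains_le_def weak_chains_def finite_lists_length_eq)

lemma complete_le_Nil [simp]: "complete_le N [] = 1"
proof -
  have "chains_le N 0 = {[]}" by (auto simp: chains_le_def weak_chains_def)
  then show ?thesis by (simp add: complete_le_def)
qed

lemma complete_le_0:
  assumes "cs \<noteq> []"
  shows "complete_le 0 cs = 0"
proof -
  have "chains_le 0 (length cs) = {}"
  proof (rule equals0I)
    fix ms assume ms: "ms \<in> chains_le 0 (length cs)"
    then have "ms \<noteq> []" using assms by (auto simp: chains_le_def weak_chains_def)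
    then have "hd ms \<in> set ms" by simp
    then show False using ms by (force simp: chains_le_def weak_chains_def)
  qed
  then show ?thesis by (simp add: complete_le_def)
qed

text \<open>A weak chain bounded by \<open>Suc N\<close> is bounded by \<open>N\<close> unless its last term equals \<open>Suc N\<close>.\<close>

lemma complete_le_snoc:
  "complete_le (Suc N) (cs @ [x]) = complete_le N (cs @ [x]) + mvar (Suc N) ^ x * complete_le (Suc N) cs"
proof -
  let ?n = "length cs"
  let ?w = "\<lambda>ms. \<Prod>k<Suc ?n. mvar (ms ! k) ^ ((cs @ [x]) ! k) :: int mseries"
  let ?snoc = "\<lambda>ms. ms @ [Suc N]"
  have "chains_le (Suc N) (Suc ?n) = chains_le N (Suc ?n) \<union> ?snoc ` chains_le (Suc N) ?n"
  proof (intro Set.set_eqI iffI)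
    fix ms assume ms: "ms \<in> chains_le (Suc N) (Suc ?n)"
    then obtain us y where us: "ms = us @ [y]"
      by (cases ms rule: rev_cases) (auto simp: chains_le_def weak_chains_def)
    show "ms \<in> chains_le N (Suc ?n) \<union> ?snoc ` chains_le (Suc N) ?n"
    proof (cases "y = Suc N")
      case True
      then have "us \<in> chains_le (Suc N) ?n"
        using ms us by (auto simp: chains_le_def weak_chains_def sorted_append)
      then show ?thesis using us True by blast
    next
      case False
      then have "ms \<in> chains_le N (Suc ?n)"
        using ms us by (force simp: chains_le_def weak_chains_def sorted_append)
      then show ?thesis ..
    qed
  qed (force simp: chains_le_def weak_chains_def sorted_append)+
  moreover have "chains_le N (Suc ?n) \<inter> ?snoc ` chains_le (Suc N) ?n = {}"
    by (force simp: chains_le_def)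
  ultimately have "complete_le (Suc N) (cs @ [x]) =
      complete_le N (cs @ [x]) + (\<Sum>ms\<in>?snoc ` chains_le (Suc N) ?n. ?w ms)"
    by (simp only: complete_le_def length_append_singleton sum.union_disjoint finite_chains_le
        finite_imageI)
  also have "(\<Sum>ms\<in>?snoc ` chains_le (Suc N) ?n. ?w ms) = (\<Sum>ms\<in>chains_le (Suc N) ?n. ?w (?snoc ms))"
    by (simp add: sum.reindex inj_on_def)
  also have "\<dots> = (\<Sum>ms\<in>chains_le (Suc N) ?n.
      mvar (Suc N) ^ x * (\<Prod>k<?n. mvar (ms ! k) ^ (cs ! k)))"
  proof (rule sum.cong)
    fix ms assume "ms \<in> chains_le (Suc N) ?n"
    then have "length ms = ?n" by (simp add: chains_le_def weak_chains_def)
    then have "?w (?snoc ms) = (\<Prod>k<?n. mvar (ms ! k) ^ (cs ! k)) * mvar (Suc N) ^ x"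
      by (simp add: nth_append)
    then show "?w (?snoc ms) = mvar (Suc N) ^ x * (\<Prod>k<?n. mvar (ms ! k) ^ (cs ! k))"
      by (simp only: mult.commute)
  qed simp
  also have "\<dots> = mvar (Suc N) ^ x * complete_le (Suc N) cs"
    by (simp add: complete_le_def sum_distrib_left)
  finally show ?thesis .
qed

lemma block_le_0: "block_le 0 n c i j = (if i = j then 1 else 0)"
  by (auto simp: block_le_def complete_le_0)

lemma block_le_col_0: "block_le N n c i 0 = (if i = 0 then 1 else 0)"
  by (simp add: block_le_def)

text \<open>One more variable acts on the columns of the block as in the interlacing expansion of
  minors, with the power of the new variable at column \<open>j\<close> given by the content \<open>j + 1 - n\<close>, a
  factor that does not depend on the row.\<close>

lemma block_le_Suc_Suc:
  "block_le (Suc N) n c i (Suc j) =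
    block_le N n c i (Suc j) + mvar (Suc N) ^ c (int j + 1 - int n) * block_le (Suc N) n c i j"
proof (cases "i \<le> j")
  case True
  have "[int i + 1 - int n..int (Suc j) - int n] =
      [int i + 1 - int n..int j - int n] @ [int j + 1 - int n]"
    using True by (subst upto_rec2) (auto simp: algebra_simps)
  then show ?thesis using True by (simp add: block_le_def complete_le_snoc)
qed (auto simp: block_le_def)

text \<open>Columns of the block are enumerated from left to right, that is, by the parts of \<open>\<nu>\<close> from
  the last to the first. In this order the horizontal strip condition becomes the interlacing
  condition on columns.\<close>

lemma strip_removals_rev:
  assumes "length \<nu> = n"
  shows "\<kappa> \<in> strip_removals \<nu> \<longleftrightarrow> length \<kappa> = n \<and>
    (\<forall>a<n. rev \<kappa> ! a \<le> rev \<nu> ! a \<and> (0 < a \<longrightarrow> rev \<nu> ! (a - 1) \<le> rev \<kappa> ! a))"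
proof -
  have "(\<forall>p<n. \<kappa> ! p \<le> \<nu> ! p \<and> (Suc p < n \<longrightarrow> \<nu> ! Suc p \<le> \<kappa> ! p)) \<longleftrightarrow>
    (\<forall>a<n. \<kappa> ! (n - Suc a) \<le> \<nu> ! (n - Suc a) \<and> (0 < a \<longrightarrow> \<nu> ! (n - a) \<le> \<kappa> ! (n - Suc a)))"
    (is "?L \<longleftrightarrow> ?R")
  proof
    assume L: ?L
    show ?R
    proof (intro allI impI conjI)
      fix a assume "a < n"
      then show "\<kappa> ! (n - Suc a) \<le> \<nu> ! (n - Suc a)" using L by simp
      assume "0 < a"
      then show "\<nu> ! (n - a) \<le> \<kappa> ! (n - Suc a)"
        using L[rule_format, of "n - Suc a"] \<open>a < n\<close> by (simp add: Suc_diff_Suc)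
    qed
  next
    assume R: ?R
    show ?L
    proof (intro allI impI conjI)
      fix p assume "p < n"
      then show "\<kappa> ! p \<le> \<nu> ! p" using R[rule_format, of "n - Suc p"] by simp
      assume "Suc p < n"
      then show "\<nu> ! Suc p \<le> \<kappa> ! p" using R[rule_format, of "n - Suc p"] by simp
    qed
  qed
  then show ?thesis using assms by (auto simp: strip_removals_def rev_nth)
qed

text \<open>The cell \<open>(p + 1, j)\<close> corresponds to the column step \<open>m = a + j - 1\<close> with \<open>a = n - 1 - p\<close>,
  so that its content \<open>j - (p + 1)\<close> equals \<open>m + 1 - n\<close>.\<close>

lemma strip_weight_rev:
  fixes f :: "int \<Rightarrow> 'a::comm_monoid_mult"
  assumes "length \<nu> = n" "length \<kappa> = n"
  shows "(\<Prod>p<n. \<Prod>j\<in>{Suc (\<kappa> ! p)..\<nu> ! p}. f (int j - int (Suc p))) =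
    (\<Prod>a<n. \<Prod>m\<in>{a + rev \<kappa> ! a..<a + rev \<nu> ! a}. f (int m + 1 - int n))"
proof -
  have "(\<Prod>p<n. \<Prod>j\<in>{Suc (\<kappa> ! p)..\<nu> ! p}. f (int j - int (Suc p))) =
      (\<Prod>a<n. \<Prod>j\<in>{Suc (\<kappa> ! (n - Suc a))..\<nu> ! (n - Suc a)}. f (int j - int (Suc (n - Suc a))))"
    by (rule prod.nat_diff_reindex[symmetric])
  also have "\<dots> = (\<Prod>a<n. \<Prod>m\<in>{a + rev \<kappa> ! a..<a + rev \<nu> ! a}. f (int m + 1 - int n))"
  proof (rule prod.cong)
    fix a assume "a \<in> {..<n}"
    then have a: "a < n" by simp
    show "(\<Prod>j\<in>{Suc (\<kappa> ! (n - Suc a))..\<nu> ! (n - Suc a)}. f (int j - int (Suc (n - Suc a)))) =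
        (\<Prod>m\<in>{a + rev \<kappa> ! a..<a + rev \<nu> ! a}. f (int m + 1 - int n))"
      by (rule prod.reindex_bij_witness[of _ "\<lambda>m. m + 1 - a" "\<lambda>j. j + a - 1"])
        (use a assms in \<open>auto simp: rev_nth of_nat_diff algebra_simps\<close>)
  qed simp
  finally show ?thesis .
qed

text \<open>The Jacobi-Trudi identity in the variables with index at most \<open>N\<close>, with exponents depending
  on contents. Both sides obey the same recursion in \<open>N\<close>: the branching rule for tableaux and the
  interlacing expansion of minors match through \<open>K a = a + rev \<kappa> ! a\<close>. For \<open>N = 0\<close> the block is an
  identity matrix followed by zero columns, so only the empty diagram gives a nonzero minor.\<close>

lemma jacobi_trudi_le:
  assumes "sorted_wrt (\<ge>) \<nu>" and "length \<nu> = n"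
  shows "det (mat n n (\<lambda>(i, a). block_le N n c i (a + rev \<nu> ! a))) = schur_le N c \<nu>"
  using assms
proof (induction N arbitrary: \<nu>)
  case (0 \<nu>)
  show ?case
  proof (cases "\<forall>x\<in>set \<nu>. x = 0")
    case True
    have "rev \<nu> ! a = 0" if "a < n" for a
      using True that 0 by (metis length_rev nth_mem set_rev)
    then have "mat n n (\<lambda>(i, a). block_le 0 n c i (a + rev \<nu> ! a)) = 1\<^sub>m n"
      by (intro eq_matI) (auto simp: block_le_0)
    then show ?thesis using True by (simp add: schur_le_0)
  next
    case False
    let ?M = "mat n n (\<lambda>(i, a). block_le 0 n c i (a + rev \<nu> ! a))"
    \<comment> \<open>The last chosen column lies beyond the identity part, hence is zero.\<close>
    obtain p where p: "p < n" "\<nu> ! p \<noteq> 0" using False 0 by (metis in_set_conv_nth)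
    then have "\<nu> ! 0 \<noteq> 0"
      using 0 by (cases "p = 0") (force simp: sorted_wrt_iff_nth_less)+
    then have last: "rev \<nu> ! (n - 1) > 0" using p 0 by (simp add: rev_nth)
    have "det ?M = (\<Sum>i<n. ?M $$ (i, n - 1) * cofactor ?M i (n - 1))"
      by (rule laplace_expansion_column) (use p in auto)
    also have "\<dots> = 0" using last p by (intro sum.neutral) (auto simp: block_le_0)
    finally show ?thesis using False by (simp only: schur_le_0 if_False)
  qed
next
  case (Suc N \<nu>)
  note len = Suc.prems(2)
  let ?x = "\<lambda>k. mvar (Suc N) ^ c k :: int mseries"
  define J where "J a = a + rev \<nu> ! a" for a
  have J_incr: "J a < J (Suc a)" if "Suc a < n" for a
  proof -
    have "\<nu> ! (n - Suc a) \<le> \<nu> ! (n - Suc (Suc a))"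
      using Suc.prems that by (auto simp: sorted_wrt_iff_nth_less)
    then show ?thesis using that len by (simp add: J_def rev_nth)
  qed
  define D where "D K = (\<Prod>a<n. \<Prod>m\<in>{K a..<J a}. ?x (int m + 1 - int n)) *
    det (mat n n (\<lambda>(i, a). block_le N n c i (K a)))" for K :: "nat \<Rightarrow> nat"
  let ?cols = "\<lambda>\<kappa>. \<lambda>a\<in>{..<n}. a + rev \<kappa> ! a"
  let ?parts = "\<lambda>K. rev (map (\<lambda>a. K a - a) [0..<n])"
  have "det (mat n n (\<lambda>(i, a). block_le (Suc N) n c i (J a))) =
      (\<Sum>K\<in>(\<Pi>\<^sub>E a\<in>{..<n}. {(if a = 0 then 0 else Suc (J (a - 1)))..J a}). D K)"
    unfolding D_def
    by (rule minor_interlacing_expansion)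
      (auto simp: block_le_col_0 block_le_Suc_Suc J_incr)
  also have "\<dots> = (\<Sum>\<kappa>\<in>strip_removals \<nu>. D (?cols \<kappa>))"
  proof (rule sum.reindex_bij_witness[of _ ?cols ?parts])
    fix K assume K: "K \<in> (\<Pi>\<^sub>E a\<in>{..<n}. {(if a = 0 then 0 else Suc (J (a - 1)))..J a})"
    have K_le: "K a \<le> J a" and K_ge: "0 < a \<Longrightarrow> Suc (J (a - 1)) \<le> K a" if "a < n" for a
      using PiE_mem[OF K, of a] that by auto
    have K_a: "a \<le> K a" if "a < n" for a
      using K_ge[OF that] by (cases a) (auto simp: J_def)
    show "?cols (?parts K) = K"
      using K_a PiE_arb[OF K] by (auto simp: restrict_def fun_eq_iff)
    then show "D (?cols (?parts K)) = D K" by simp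
    show "?parts K \<in> strip_removals \<nu>"
      unfolding strip_removals_rev[OF len]
    proof (intro conjI allI impI)
      fix a assume a: "a < n"
      then show "rev (?parts K) ! a \<le> rev \<nu> ! a" using K_le[OF a] by (simp add: J_def)
      assume "0 < a"
      then show "rev \<nu> ! (a - 1) \<le> rev (?parts K) ! a" using K_ge[OF a] a by (simp add: J_def)
    qed simp
  next
    fix \<kappa> assume \<kappa>: "\<kappa> \<in> strip_removals \<nu>"
    then have len_\<kappa>: "length \<kappa> = n" and le: "\<And>a. a < n \<Longrightarrow> rev \<kappa> ! a \<le> rev \<nu> ! a"
      and ge: "\<And>a. a < n \<Longrightarrow> 0 < a \<Longrightarrow> rev \<nu> ! (a - 1) \<le> rev \<kappa> ! a"
      unfolding strip_removals_rev[OF len] by auto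
    have "rev (?parts (?cols \<kappa>)) = rev \<kappa>"
      using len_\<kappa> by (intro nth_equalityI) auto
    then show "?parts (?cols \<kappa>) = \<kappa>" by simp
    show "?cols \<kappa> \<in> (\<Pi>\<^sub>E a\<in>{..<n}. {(if a = 0 then 0 else Suc (J (a - 1)))..J a})"
    proof (rule restrict_PiE_iff[THEN iffD2], rule ballI)
      fix a assume "a \<in> {..<n}"
      then have a: "a < n" by simp
      show "a + rev \<kappa> ! a \<in> {(if a = 0 then 0 else Suc (J (a - 1)))..J a}"
        using le[OF a] ge[OF a] by (cases a) (auto simp: J_def)
    qed
  qed
  also have "\<dots> = (\<Sum>\<kappa>\<in>strip_removals \<nu>.
      (\<Prod>p<n. \<Prod>j\<in>{Suc (\<kappa> ! p)..\<nu> ! p}. ?x (int j - int (Suc p))) * schur_le N c \<kappa>)"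
  proof (rule sum.cong)
    fix \<kappa> assume \<kappa>: "\<kappa> \<in> strip_removals \<nu>"
    then have len_\<kappa>: "length \<kappa> = n" by (simp add: strip_removals_def len)
    have "sorted_wrt (\<ge>) \<kappa>"
    proof -
      have "\<kappa> ! q \<le> \<kappa> ! p" if "p < q" "q < n" for p q
      proof -
        have "\<kappa> ! q \<le> \<nu> ! q" using \<kappa> that len by (simp add: strip_removals_def)
        also have "\<dots> \<le> \<nu> ! Suc p"
          using Suc.prems that by (cases "Suc p = q") (auto simp: sorted_wrt_iff_nth_less)
        also have "\<dots> \<le> \<kappa> ! p" using \<kappa> that len by (simp add: strip_removals_def)
        finally show ?thesis .
      qed
      then show ?thesis using len_\<kappa> by (auto simp: sorted_wrt_iff_nth_less)
    qed
    then have IH: "det (mat n n (\<lambda>(i, a). block_le N n c i (a + rev \<kappa> ! a))) = schur_le N c \<kappa>"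
      using Suc.IH len_\<kappa> by blast
    have "mat n n (\<lambda>(i, a). block_le N n c i (?cols \<kappa> a)) =
        mat n n (\<lambda>(i, a). block_le N n c i (a + rev \<kappa> ! a))"
      by (rule eq_matI) auto
    moreover have "(\<Prod>a<n. \<Prod>m\<in>{?cols \<kappa> a..<J a}. ?x (int m + 1 - int n)) =
        (\<Prod>a<n. \<Prod>m\<in>{a + rev \<kappa> ! a..<a + rev \<nu> ! a}. ?x (int m + 1 - int n))"
      by (rule prod.cong) (auto simp: J_def)
    ultimately show "D (?cols \<kappa>) =
        (\<Prod>p<n. \<Prod>j\<in>{Suc (\<kappa> ! p)..\<nu> ! p}. ?x (int j - int (Suc p))) * schur_le N c \<kappa>"
      unfolding D_def by (simp only: IH strip_weight_rev[OF len len_\<kappa>, of ?x])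
  qed simp
  also have "\<dots> = schur_le (Suc N) c \<nu>"
    using schur_le_Suc[OF Suc.prems(1), of N c] by (simp only: len)
  finally show ?case by (simp only: J_def)
qed

section \<open>Column sets of partitions in a box\<close>

text \<open>The beta-numbers of \<open>\<nu>\<close>: the columns of the block whose maximal minor is the Jacobi-Trudi
  determinant of \<open>\<nu>\<close>.\<close>

definition column_set :: "nat list \<Rightarrow> nat set" where
  "column_set \<nu> = (\<lambda>k. k + rev \<nu> ! k) ` {..<length \<nu>}"

lemma sorted_list_of_column_set:
  assumes "sorted_wrt (\<ge>) \<nu>"
  shows "sorted_list_of_set (column_set \<nu>) = map (\<lambda>k. k + rev \<nu> ! k) [0..<length \<nu>]"
proof -
  have "rev \<nu> ! k \<le> rev \<nu> ! l" if "k < l" "l < length \<nu>" for k l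
    using assms that by (auto simp: sorted_wrt_iff_nth_less rev_nth)
  then have "sorted_wrt (<) (map (\<lambda>k. k + rev \<nu> ! k) [0..<length \<nu>])"
    by (auto simp: sorted_wrt_iff_nth_less intro!: add_less_le_mono)
  then show ?thesis
    by (intro sorted_distinct_set_unique)
      (auto simp: strict_sorted_iff column_set_def)
qed

lemma card_column_set:
  assumes "sorted_wrt (\<ge>) \<nu>"
  shows "card (column_set \<nu>) = length \<nu>"
  using sorted_list_of_column_set[OF assms] by (metis length_map length_sorted_list_of_set length_upt diff_zero)

lemma sum_column_set:
  assumes "sorted_wrt (\<ge>) \<nu>"
  shows "\<Sum>(column_set \<nu>) = \<Sum>{..<length \<nu>} + sum_list \<nu>"
proof -
  have "\<Sum>(column_set \<nu>) = sum_list (sorted_list_of_set (column_set \<nu>))"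
    by (subst sum_list_distinct_conv_sum_set[of _ "\<lambda>x. x", simplified]) (auto simp: column_set_def)
  also have "\<dots> = (\<Sum>k<length \<nu>. k + rev \<nu> ! k)"
    by (simp add: sorted_list_of_column_set[OF assms] interv_sum_list_conv_sum_set_nat atLeast0LessThan)
  also have "\<dots> = \<Sum>{..<length \<nu>} + sum_list (rev \<nu>)"
    by (simp add: sum.distrib sum_list_sum_nth atLeast0LessThan)
  finally show ?thesis by (simp add: sum_list_rev)
qed

text \<open>The duality between a partition and its conjugate, with a 0-based row index.\<close>

lemma conj_part_iff:
  assumes "sorted_wrt (\<ge>) \<nu>" "p < length \<nu>"
  shows "p < conj_part \<nu> i \<longleftrightarrow> i \<le> \<nu> ! p"
proof -
  have "{j. 1 \<le> j \<and> j \<le> length \<nu> \<and> i \<le> \<nu> ! (j - 1)} = {1..conj_part \<nu> i}"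
    unfolding conj_part_def
  proof (rule initial_segment_eq_atLeastAtMost)
    fix j k assume *: "1 \<le> j" "j \<le> k" "k \<le> length \<nu>" "i \<le> \<nu> ! (k - 1)"
    then have "\<nu> ! (k - 1) \<le> \<nu> ! (j - 1)"
      using assms by (cases "j = k") (auto simp: sorted_wrt_iff_nth_less)
    with * show "i \<le> \<nu> ! (j - 1)" by simp
  qed
  then have "Suc p \<in> {j. 1 \<le> j \<and> j \<le> length \<nu> \<and> i \<le> \<nu> ! (j - 1)} \<longleftrightarrow> Suc p \<in> {1..conj_part \<nu> i}"
    by simp
  then show ?thesis using assms(2) by auto
qed

lemma conj_part_le_length: "conj_part \<nu> i \<le> length \<nu>"
proof -
  have "conj_part \<nu> i \<le> card {1..length \<nu>}"
    unfolding conj_part_def by (intro card_mono) auto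
  then show ?thesis by simp
qed

lemma conj_part_antimono:
  assumes "i \<le> k"
  shows "conj_part \<nu> k \<le> conj_part \<nu> i"
  unfolding conj_part_def
  by (rule card_mono, rule finite_subset[of _ "{..length \<nu>}"]) (use assms in auto)

lemma length_dual_partition [simp]: "length (dual_partition r s \<nu>) = s"
  by (simp add: dual_partition_def)

lemma rev_dual_partition_nth:
  "b < s \<Longrightarrow> rev (dual_partition r s \<nu>) ! b = r - conj_part \<nu> (Suc b)"
  by (simp add: dual_partition_def rev_map del: upt_Suc)

lemma dual_partition_in_box: "dual_partition r s \<nu> \<in> partitions_in_box s r"
proof -
  have "sorted_wrt (\<le>) (rev (dual_partition r s \<nu>))"
    by (auto simp: sorted_wrt_iff_nth_less rev_dual_partition_nth
        intro!: diff_le_mono2 conj_part_antimono)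
  then have "sorted_wrt (\<ge>) (dual_partition r s \<nu>)" by (simp add: sorted_wrt_rev)
  then show ?thesis by (auto simp: partitions_in_box_def dual_partition_def)
qed

lemma column_set_subset:
  assumes "\<nu> \<in> partitions_in_box r s"
  shows "column_set \<nu> \<subseteq> {..<r + s}"
proof -
  have "k + rev \<nu> ! k < r + s" if "k < r" for k
  proof -
    have "rev \<nu> ! k \<in> set \<nu>" using assms that nth_mem[of k "rev \<nu>"]
      by (simp add: partitions_in_box_def)
    then show ?thesis using assms that by (auto simp: partitions_in_box_def)
  qed
  then show ?thesis using assms by (auto simp: column_set_def partitions_in_box_def)
qed

text \<open>This is where \<open>\<nu>\<close> and its dual meet: the columns that are left for the second block are
  those that belong to the dual partition. It suffices to see that the two column sets are
  disjoint, since their sizes add up to \<open>r + s\<close>. For row \<open>p = r - 1 - k\<close> and column \<open>b\<close>, the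
  number \<open>k + \<nu> ! p\<close> lies above or below \<open>b + (r - conj_part \<nu> (b + 1))\<close> according to whether \<open>\<nu>\<close>
  contains the cell in row \<open>p\<close> and column \<open>b\<close>, counted from 0.\<close>

lemma column_set_dual_partition:
  assumes \<nu>: "\<nu> \<in> partitions_in_box r s"
  shows "column_set (dual_partition r s \<nu>) = {..<r + s} - column_set \<nu>"
proof -
  let ?\<nu>' = "dual_partition r s \<nu>"
  have sorted: "sorted_wrt (\<ge>) \<nu>" and len: "length \<nu> = r" using \<nu> by (auto simp: partitions_in_box_def)
  have sorted': "sorted_wrt (\<ge>) ?\<nu>'"
    using dual_partition_in_box[of r s \<nu>] by (simp add: partitions_in_box_def)
  have "k + rev \<nu> ! k \<noteq> b + rev ?\<nu>' ! b" if "k < r" "b < s" for k b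
  proof -
    have "conj_part \<nu> (Suc b) \<le> r" using conj_part_le_length[of \<nu>] len by simp
    moreover have "rev \<nu> ! k = \<nu> ! (r - Suc k)" using that len by (simp add: rev_nth)
    ultimately show ?thesis
      unfolding rev_dual_partition_nth[OF that(2)]
      using conj_part_iff[OF sorted, of "r - Suc k" "Suc b"] that len by auto
  qed
  then have "column_set \<nu> \<inter> column_set ?\<nu>' = {}"
    by (auto simp: column_set_def len)
  moreover have "column_set ?\<nu>' \<subseteq> {..<r + s}"
    using column_set_subset[OF dual_partition_in_box[of r s \<nu>]] by (simp add: add.commute)
  moreover have "card ({..<r + s} - column_set \<nu>) = s"
    using column_set_subset[OF \<nu>] card_column_set[OF sorted] len
    by (subst card_Diff_subset) (auto intro: finite_subset)
  ultimately show ?thesis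
    using card_column_set[OF sorted'] by (intro card_subset_eq) auto
qed

lemma strict_sorted_nth_gap:
  assumes "sorted_wrt (<) (xs :: nat list)" "i \<le> j" "j < length xs"
  shows "xs ! i + (j - i) \<le> xs ! j"
  using assms(2,3)
proof (induction rule: dec_induct)
  case (step j)
  then have "xs ! j < xs ! Suc j" using assms(1) by (simp add: sorted_wrt_iff_nth_less)
  then show ?case using step by simp
qed simp

lemma bij_betw_column_set:
  "bij_betw column_set (partitions_in_box r s) {J. J \<subseteq> {..<r + s} \<and> card J = r}"
proof -
  let ?parts = "\<lambda>J. rev (map (\<lambda>k. sorted_list_of_set J ! k - k) [0..<r])"
  have parts: "column_set (?parts J) = J \<and> ?parts J \<in> partitions_in_box r s"
    if J: "J \<subseteq> {..<r + s}" "card J = r" for J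
  proof -
    have fin: "finite J" using J(1) by (rule finite_subset) simp
    let ?xs = "sorted_list_of_set J"
    have gap: "?xs ! k + (l - k) \<le> ?xs ! l" if "k \<le> l" "l < r" for k l
      using that J by (intro strict_sorted_nth_gap) auto
    have ge: "k \<le> ?xs ! k" if "k < r" for k using gap[of 0 k] that by simp
    have "(\<lambda>k. k + rev (?parts J) ! k) ` {..<r} = (\<lambda>k. ?xs ! k) ` {..<r}"
      by (rule image_cong) (auto simp: ge)
    also have "\<dots> = set ?xs" using J by (auto simp: in_set_conv_nth)
    finally have cols: "column_set (?parts J) = J" using fin by (simp add: column_set_def)
    have le: "?xs ! k - k \<le> s" if "k < r" for k
    proof -
      have "?xs ! (r - 1) \<in> set ?xs" by (rule nth_mem) (use J that in auto)
      then have "?xs ! (r - 1) < r + s" using J fin by auto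
      moreover have "?xs ! k + (r - 1 - k) \<le> ?xs ! (r - 1)" using that by (intro gap) auto
      ultimately show ?thesis using that by simp
    qed
    have "sorted_wrt (\<le>) (map (\<lambda>k. ?xs ! k - k) [0..<r])"
    proof -
      have "?xs ! k - k \<le> ?xs ! l - l" if "k < l" "l < r" for k l
        using gap[of k l] that by simp
      then show ?thesis by (simp add: sorted_wrt_iff_nth_less)
    qed
    then have "?parts J \<in> partitions_in_box r s"
      using le by (auto simp: partitions_in_box_def sorted_wrt_rev)
    with cols show ?thesis ..
  qed
  show ?thesis
  proof (rule bij_betwI[where g = ?parts])
    show "column_set \<in> partitions_in_box r s \<rightarrow> {J. J \<subseteq> {..<r + s} \<and> card J = r}"
    proof
      fix \<nu> assume \<nu>: "\<nu> \<in> partitions_in_box r s"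
      then show "column_set \<nu> \<in> {J. J \<subseteq> {..<r + s} \<and> card J = r}"
        using column_set_subset[OF \<nu>] card_column_set[of \<nu>] by (auto simp: partitions_in_box_def)
    qed
  next
    fix \<nu> assume "\<nu> \<in> partitions_in_box r s"
    then have \<nu>: "sorted_wrt (\<ge>) \<nu>" "length \<nu> = r" by (auto simp: partitions_in_box_def)
    have "map (\<lambda>k. sorted_list_of_set (column_set \<nu>) ! k - k) [0..<r] = rev \<nu>"
      unfolding sorted_list_of_column_set[OF \<nu>(1)] by (rule nth_equalityI) (auto simp: \<nu>(2))
    then show "rev (map (\<lambda>k. sorted_list_of_set (column_set \<nu>) ! k - k) [0..<r]) = \<nu>" by simp
  qed (use parts in auto)
qed

text \<open>Laplace expansion along the first \<open>r\<close> rows, with the column sets encoded by partitions in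
  the \<open>r \<times> s\<close> box. The sign exponent is \<open>\<Sum>J - \<Sum>{..<r}\<close> up to an even number, which is the size of
  the partition.\<close>

lemma laplace_expansion_by_partitions:
  fixes A :: "nat \<Rightarrow> nat \<Rightarrow> 'a::comm_ring_1"
  shows "det (mat (r + s) (r + s) (\<lambda>(i, j). A i j)) =
    (\<Sum>\<nu>\<in>partitions_in_box r s. (- 1) ^ sum_list \<nu>
      * det (mat r r (\<lambda>(i, k). A i (k + rev \<nu> ! k)))
      * det (mat s s (\<lambda>(i, k). A (r + i) (k + rev (dual_partition r s \<nu>) ! k))))"
proof -
  let ?z = "\<lambda>J. mat (r + s) (r + s) (\<lambda>(i, j). if i < r \<longleftrightarrow> j \<in> J then A i j else 0)"
  have "det (mat (r + s) (r + s) (\<lambda>(i, j). A i j)) =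
      (\<Sum>J | J \<subseteq> {..<r + s} \<and> card J = r. det (?z J))"
    by (rule det_sum_over_column_sets) simp
  also have "\<dots> = (\<Sum>\<nu>\<in>partitions_in_box r s. det (?z (column_set \<nu>)))"
    by (rule sum.reindex_bij_betw[OF bij_betw_column_set, symmetric])
  also have "\<dots> = (\<Sum>\<nu>\<in>partitions_in_box r s. (- 1) ^ sum_list \<nu>
      * det (mat r r (\<lambda>(i, k). A i (k + rev \<nu> ! k)))
      * det (mat s s (\<lambda>(i, k). A (r + i) (k + rev (dual_partition r s \<nu>) ! k))))"
  proof (rule sum.cong)
    fix \<nu> assume \<nu>: "\<nu> \<in> partitions_in_box r s"
    then have sorted: "sorted_wrt (\<ge>) \<nu>" and len: "length \<nu> = r"
      by (auto simp: partitions_in_box_def)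
    let ?\<nu>' = "dual_partition r s \<nu>"
    have sorted': "sorted_wrt (\<ge>) ?\<nu>'"
      using dual_partition_in_box[of r s \<nu>] by (simp add: partitions_in_box_def)
    have cols: "sorted_list_of_set (column_set \<nu>) = map (\<lambda>k. k + rev \<nu> ! k) [0..<r]"
      using sorted_list_of_column_set[OF sorted] len by simp
    have cols': "sorted_list_of_set ({..<r + s} - column_set \<nu>) = map (\<lambda>k. k + rev ?\<nu>' ! k) [0..<s]"
      using sorted_list_of_column_set[OF sorted'] column_set_dual_partition[OF \<nu>] by simp
    have sign: "(- 1 :: 'a) ^ (\<Sum>(column_set \<nu>) + \<Sum>{..<r}) = (- 1) ^ sum_list \<nu>"
      using sum_column_set[OF sorted] len by (auto simp: minus_one_power_iff)
    have "det (?z (column_set \<nu>)) = (- 1) ^ (\<Sum>(column_set \<nu>) + \<Sum>{..<r})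
      * det (mat r r (\<lambda>(i, k). A i (sorted_list_of_set (column_set \<nu>) ! k)))
      * det (mat s s (\<lambda>(i, k). A (r + i) (sorted_list_of_set ({..<r + s} - column_set \<nu>) ! k)))"
      using column_set_subset[OF \<nu>] card_column_set[OF sorted] len
      by (intro det_zeroed_to_column_set) auto
    also have "mat r r (\<lambda>(i, k). A i (sorted_list_of_set (column_set \<nu>) ! k)) =
        mat r r (\<lambda>(i, k). A i (k + rev \<nu> ! k))"
      unfolding cols by (rule eq_matI) auto
    also have "mat s s (\<lambda>(i, k). A (r + i) (sorted_list_of_set ({..<r + s} - column_set \<nu>) ! k)) =
        mat s s (\<lambda>(i, k). A (r + i) (k + rev ?\<nu>' ! k))"
      unfolding cols' by (rule eq_matI) auto
    finally show "det (?z (column_set \<nu>)) = (- 1) ^ sum_list \<nu>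
      * det (mat r r (\<lambda>(i, k). A i (k + rev \<nu> ! k)))
      * det (mat s s (\<lambda>(i, k). A (r + i) (k + rev ?\<nu>' ! k)))"
      unfolding sign .
  qed simp
  finally show ?thesis .
qed

section \<open>Truncation to finitely many variables\<close>

text \<open>Setting to zero all variables with index above \<open>N\<close>.\<close>

lift_definition trunc :: "nat \<Rightarrow> 'a::comm_ring_1 mseries \<Rightarrow> 'a mseries"
  is "\<lambda>N f \<mu>. if Poly_Mapping.keys \<mu> \<subseteq> {..N} then f \<mu> else 0" .

lemma keys_add_nat: "Poly_Mapping.keys (\<alpha> + \<beta>) = Poly_Mapping.keys \<alpha> \<union> Poly_Mapping.keys \<beta>"
  for \<alpha> \<beta> :: "nat \<Rightarrow>\<^sub>0 nat"
  by (auto simp: in_keys_iff lookup_add)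

lemma trunc_mult: "trunc N (f * g) = trunc N f * trunc N g"
proof (rule mseries_eqI)
  fix \<mu>
  have "(\<Sum>(\<alpha>, \<beta>)\<in>splits \<mu>. mcoeff (trunc N f) \<alpha> * mcoeff (trunc N g) \<beta>) =
      (\<Sum>(\<alpha>, \<beta>)\<in>splits \<mu>. if Poly_Mapping.keys \<mu> \<subseteq> {..N} then mcoeff f \<alpha> * mcoeff g \<beta> else 0)"
    by (rule sum.cong) (auto simp: splits_def keys_add_nat trunc.rep_eq)
  then show "mcoeff (trunc N (f * g)) \<mu> = mcoeff (trunc N f * trunc N g) \<mu>"
    by (simp add: trunc.rep_eq times_mseries.rep_eq)
qed

interpretation trunc: comm_ring_hom "trunc N" for N
proof
  show "trunc N 1 = (1 :: 'a mseries)"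
    by (rule mseries_eqI) (simp add: trunc.rep_eq one_mseries.rep_eq)
  show "trunc N 0 = (0 :: 'a mseries)"
    by (rule mseries_eqI) (simp add: trunc.rep_eq zero_mseries.rep_eq)
  show "trunc N (f + g) = trunc N f + trunc N g" for f g :: "'a mseries"
    by (rule mseries_eqI) (simp add: trunc.rep_eq plus_mseries.rep_eq)
qed (rule trunc_mult)

text \<open>A single monomial involves finitely many variables, so truncations separate series.\<close>

lemma trunc_eqI:
  assumes "\<And>N. trunc N f = trunc N g"
  shows "f = g"
proof (rule mseries_eqI)
  fix \<mu> :: "nat \<Rightarrow>\<^sub>0 nat"
  obtain N where "Poly_Mapping.keys \<mu> \<subseteq> {..N}"
    using finite_nat_set_iff_bounded_le[of "Poly_Mapping.keys \<mu>"] by auto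
  then show "mcoeff f \<mu> = mcoeff g \<mu>"
    using arg_cong[OF assms[of N], of "\<lambda>h. mcoeff h \<mu>"] by (simp add: trunc.rep_eq)
qed

lemma mcoeff_sum: "mcoeff (sum f A) \<mu> = (\<Sum>x\<in>A. mcoeff (f x) \<mu>)"
  by (induction A rule: infinite_finite_induct) (auto simp: zero_mseries.rep_eq plus_mseries.rep_eq)

text \<open>After truncation an infinite sum of monomials becomes the finite sum of those that use small
  variables only. Exponent 0 must be excluded, as a large variable with this exponent would
  survive.\<close>

lemma trunc_mseries_sum:
  fixes v :: "'i \<Rightarrow> 'p \<Rightarrow> nat"
  assumes D: "finite D" and pos: "\<And>p. p \<in> D \<Longrightarrow> 0 < g p"
    and fin: "finite {m \<in> A. \<forall>p\<in>D. v m p \<le> N}"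
  shows "trunc N (mseries_sum A (\<lambda>m. \<Prod>p\<in>D. mvar (v m p) ^ g p)) =
    (\<Sum>m | m \<in> A \<and> (\<forall>p\<in>D. v m p \<le> N). \<Prod>p\<in>D. mvar (v m p) ^ g p :: 'a::comm_ring_1 mseries)"
proof (rule mseries_eqI)
  fix \<mu>
  let ?A = "{m \<in> A. \<forall>p\<in>D. v m p \<le> N}"
  define F :: "'i \<Rightarrow> 'a" where "F m = mcoeff (\<Prod>p\<in>D. mvar (v m p) ^ g p) \<mu>" for m
  show "mcoeff (trunc N (mseries_sum A (\<lambda>m. \<Prod>p\<in>D. mvar (v m p) ^ g p))) \<mu> =
      mcoeff (\<Sum>m\<in>?A. \<Prod>p\<in>D. mvar (v m p) ^ g p :: 'a mseries) \<mu>"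
  proof (cases "Poly_Mapping.keys \<mu> \<subseteq> {..N}")
    case True
    have "v m p \<le> N" if "F m \<noteq> 0" "p \<in> D" for m p
      using prod_mvar_power_coeff_nonzero[where m = "v m" and g = g, OF D that(2) pos[OF that(2)]]
        that(1) True by (auto simp: F_def)
    then have "(\<Sum>m | m \<in> A \<and> F m \<noteq> 0. F m) = (\<Sum>m\<in>?A. F m)"
      by (intro sum.mono_neutral_left fin) auto
    then show ?thesis
      using True by (simp add: trunc.rep_eq mseries_sum.rep_eq mcoeff_sum F_def)
  next
    case False
    have "F m = 0" if "m \<in> ?A" for m
    proof (rule ccontr)
      assume "F m \<noteq> 0"
      then have \<mu>: "\<mu> = (\<Sum>p\<in>D. Poly_Mapping.single (v m p) (g p))"
        by (auto simp: F_def prod_mvar_power[OF D] mcoeff_mmonom split: if_splits)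
      have "Poly_Mapping.keys \<mu> \<subseteq> (\<Union>p\<in>D. Poly_Mapping.keys (Poly_Mapping.single (v m p) (g p)))"
        unfolding \<mu> by (rule keys_sum)
      also have "\<dots> \<subseteq> {..N}" using that by auto
      finally show False using False by blast
    qed
    then show ?thesis using False by (simp add: trunc.rep_eq mcoeff_sum F_def)
  qed
qed

lemma trunc_schur_S:
  assumes c: "\<And>i j. (i, j) \<in> diagram \<nu> \<Longrightarrow> \<gamma> (i, j) = c (int j - int i)"
    and pos: "\<And>q. q \<in> diagram \<nu> \<Longrightarrow> 0 < \<gamma> q"
  shows "trunc N (schur_S \<nu> \<gamma>) = schur_le N c \<nu>"
proof -
  have "trunc N (schur_S \<nu> \<gamma>) = (\<Sum>m\<in>SSYT_le N \<nu>. \<Prod>q\<in>diagram \<nu>. mvar (m q) ^ \<gamma> q)"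
    unfolding schur_S_def SSYT_le_def
    by (rule trunc_mseries_sum) (use pos finite_SSYT_le[of N \<nu>] in \<open>auto simp: SSYT_le_def\<close>)
  also have "\<dots> = schur_le N c \<nu>"
    unfolding schur_le_def by (intro sum.cong prod.cong) (auto simp: c)
  finally show ?thesis .
qed

lemma trunc_E_series:
  assumes "\<forall>x\<in>set cs. 0 < x"
  shows "trunc N (E_series cs) = complete_le N cs"
proof -
  have chains: "{ms \<in> weak_chains (length cs). \<forall>k\<in>{..<length cs}. ms ! k \<le> N} = chains_le N (length cs)"
    by (auto simp: chains_le_def weak_chains_def all_set_conv_all_nth)
  show ?thesis
    unfolding E_series_def complete_le_def chains[symmetric]
    by (rule trunc_mseries_sum) (use assms in \<open>auto simp: chains simp del: lessThan_iff Ball_def\<close>)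
qed

lemma trunc_block_entry:
  assumes "\<And>k. 1 - int n \<le> k \<Longrightarrow> k < int \<eta> - int n \<Longrightarrow> 0 < c k" and "j < \<eta>"
  shows "trunc N (block_entry n c (Suc i) (Suc j)) = block_le N n c i j"
proof -
  have "trunc N (E_series (map c [int i + 1 - int n..int j - int n])) =
      complete_le N (map c [int i + 1 - int n..int j - int n])"
    by (rule trunc_E_series) (use assms in auto)
  then show ?thesis by (auto simp: block_entry_def block_le_def algebra_simps)
qed

lemma diagram_subset_box:
  assumes "\<nu> \<in> partitions_in_box r s"
  shows "diagram \<nu> \<subseteq> diagram (replicate r s)"
proof clarify
  fix i j assume ij: "(i, j) \<in> diagram \<nu>"
  have len: "length \<nu> = r" using assms by (simp add: partitions_in_box_def)
  then have "\<nu> ! (i - 1) \<in> set \<nu>" using ij by (auto simp: diagram_def)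
  then have "\<nu> ! (i - 1) \<le> s" using assms by (simp add: partitions_in_box_def)
  then show "(i, j) \<in> diagram (replicate r s)" using ij len by (auto simp: diagram_def)
qed

text \<open>Every content that occurs in the block occurs in the box, on its first row or first column,
  so the exponents are positive and the truncation of the infinite sums applies.\<close>

lemma trunc_block_and_schur:
  assumes fill: "\<gamma> \<in> diag_fillings (replicate r s)"
    and contents: "\<forall>(i, j)\<in>diagram (replicate r s). c (int j - int i) = \<gamma> (i, j)"
    and "0 < r" "0 < s"
  shows "i < r \<Longrightarrow> j < r + s \<Longrightarrow> trunc N (block_entry r c (Suc i) (Suc j)) = block_le N r c i j"
    and "\<nu> \<in> partitions_in_box r s \<Longrightarrow>
      trunc N (schur_S \<nu> (restrict \<gamma> (diagram \<nu>))) = schur_le N c \<nu>"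
proof -
  have c: "c (int j - int i) = \<gamma> (i, j)" if "(i, j) \<in> diagram (replicate r s)" for i j
    using contents that by blast
  have pos: "0 < \<gamma> q" if "q \<in> diagram (replicate r s)" for q
  proof -
    have "\<gamma> \<in> diagram (replicate r s) \<rightarrow>\<^sub>E {1..}"
      using fill by (simp add: diag_fillings_def fillings_def)
    from PiE_mem[OF this that] show ?thesis by simp
  qed
  have c_pos: "0 < c k" if k: "1 - int r \<le> k" "k < int (r + s) - int r" for k
  proof (cases "0 \<le> k")
    case True
    then have "(1, nat k + 1) \<in> diagram (replicate r s)" using k assms by (auto simp: diagram_def)
    from pos[OF this] c[OF this] show ?thesis using True by simp
  next
    case False
    then have "(nat (1 - k), 1) \<in> diagram (replicate r s)" using k assms by (auto simp: diagram_def)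
    from pos[OF this] c[OF this] show ?thesis using False by simp
  qed
  show "trunc N (block_entry r c (Suc i) (Suc j)) = block_le N r c i j" if "i < r" "j < r + s"
    using c_pos that by (intro trunc_block_entry[where \<eta> = "r + s"]) auto
  assume \<nu>: "\<nu> \<in> partitions_in_box r s"
  show "trunc N (schur_S \<nu> (restrict \<gamma> (diagram \<nu>))) = schur_le N c \<nu>"
    using diagram_subset_box[OF \<nu>] by (intro trunc_schur_S) (auto simp: c pos)
qed

section \<open>The determinantal identity\<close>

theorem theorem5p5:
  fixes r s \<eta> :: nat
    and \<gamma> \<delta> :: "nat \<times> nat \<Rightarrow> nat"
    and c d :: "int \<Rightarrow> nat"
  assumes "0 < r" and "0 < s" and "\<eta> = r + s"
    and "\<gamma> \<in> diag_fillings (replicate r s)"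
    and "\<delta> \<in> diag_fillings (replicate s r)"
    and "\<And>i j. (i, j) \<in> diagram (replicate r s) \<Longrightarrow> c (int j - int i) = \<gamma> (i, j)"
    and "\<And>i j. (i, j) \<in> diagram (replicate s r) \<Longrightarrow> d (int j - int i) = \<delta> (i, j)"
  shows "(\<Sum>\<nu>\<in>partitions_in_box r s.
            (- 1) ^ sum_list \<nu>
            * schur_S \<nu> (restrict \<gamma> (diagram \<nu>))
            * schur_S (dual_partition r s \<nu>) (restrict \<delta> (diagram (dual_partition r s \<nu>))))
         = det (block_mat r \<eta> c @\<^sub>r block_mat s \<eta> d)"
    (is "?lhs = det ?B")
proof (rule trunc_eqI)
  fix N
  have "\<forall>(i, j)\<in>diagram (replicate r s). c (int j - int i) = \<gamma> (i, j)"
    using assms(6) by blast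
  note c = trunc_block_and_schur[OF assms(4) this assms(1,2)]
  have "\<forall>(i, j)\<in>diagram (replicate s r). d (int j - int i) = \<delta> (i, j)"
    using assms(7) by blast
  note d = trunc_block_and_schur[OF assms(5) this assms(2,1)]
  let ?A = "\<lambda>i j. if i < r then block_le N r c i j else block_le N s d (i - r) j"
  have "trunc N (det ?B) = det (map_mat (trunc N) ?B)" by (rule trunc.hom_det[symmetric])
  also have "map_mat (trunc N) ?B = mat (r + s) (r + s) (\<lambda>(i, j). ?A i j)"
    by (rule eq_matI)
      (auto simp: append_rows_def block_mat_def assms(3) c(1) d(1) add.commute)
  also have "det \<dots> = (\<Sum>\<nu>\<in>partitions_in_box r s. (- 1) ^ sum_list \<nu>
      * det (mat r r (\<lambda>(i, k). ?A i (k + rev \<nu> ! k)))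
      * det (mat s s (\<lambda>(i, k). ?A (r + i) (k + rev (dual_partition r s \<nu>) ! k))))"
    by (rule laplace_expansion_by_partitions)
  also have "\<dots> = (\<Sum>\<nu>\<in>partitions_in_box r s. (- 1) ^ sum_list \<nu>
      * trunc N (schur_S \<nu> (restrict \<gamma> (diagram \<nu>)))
      * trunc N (schur_S (dual_partition r s \<nu>) (restrict \<delta> (diagram (dual_partition r s \<nu>)))))"
  proof (rule sum.cong)
    fix \<nu> assume \<nu>: "\<nu> \<in> partitions_in_box r s"
    let ?\<nu>' = "dual_partition r s \<nu>"
    have \<nu>': "?\<nu>' \<in> partitions_in_box s r" by (rule dual_partition_in_box)
    have "mat r r (\<lambda>(i, k). ?A i (k + rev \<nu> ! k)) =
        mat r r (\<lambda>(i, k). block_le N r c i (k + rev \<nu> ! k))"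
      by (rule eq_matI) auto
    moreover have "mat s s (\<lambda>(i, k). ?A (r + i) (k + rev ?\<nu>' ! k)) =
        mat s s (\<lambda>(i, k). block_le N s d i (k + rev ?\<nu>' ! k))"
      by (rule eq_matI) auto
    moreover have "det (mat r r (\<lambda>(i, k). block_le N r c i (k + rev \<nu> ! k))) = schur_le N c \<nu>"
      using \<nu> by (intro jacobi_trudi_le) (auto simp: partitions_in_box_def)
    moreover have "det (mat s s (\<lambda>(i, k). block_le N s d i (k + rev ?\<nu>' ! k))) = schur_le N d ?\<nu>'"
      using \<nu>' by (intro jacobi_trudi_le) (auto simp: partitions_in_box_def)
    ultimately show "(- 1) ^ sum_list \<nu>
        * det (mat r r (\<lambda>(i, k). ?A i (k + rev \<nu> ! k)))
        * det (mat s s (\<lambda>(i, k). ?A (r + i) (k + rev ?\<nu>' ! k))) =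
      (- 1) ^ sum_list \<nu>
        * trunc N (schur_S \<nu> (restrict \<gamma> (diagram \<nu>)))
        * trunc N (schur_S ?\<nu>' (restrict \<delta> (diagram ?\<nu>')))"
      by (simp only: c(2)[OF \<nu>] d(2)[OF \<nu>'])
  qed simp
  also have "\<dots> = trunc N ?lhs"
    by (simp add: trunc.hom_sum trunc.hom_mult trunc.hom_power trunc.hom_uminus)
  finally show "trunc N ?lhs = trunc N (det ?B)" by (rule sym)
qed

end
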